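(* Let $B$ be the unit ball of $\mathbb R^3$, $z\in\mathbb R^3$, $a>0$, $D=z+aB$ (a ball of radius $a$), and $c_1>0$. Let $\lambda_1>\lambda_2>\cdots$ be the eigenvalues of the Newtonian operator $N$ on $L^2(D)$ whose eigenspace contains a function $e$ with $\int_D e(y)\,dy\neq0$, listed without repetition in decreasing order, and set $\omega_n=c_1/\sqrt{\lambda_n}$ and $b=c_1\pi/a$. Then the family $\{\sin(\omega_n t),\cos(\omega_n t)\}_{n\in\mathbb N}$ is a Riesz basis of $L^2[-\pi/b,\pi/b]$.
   Context: The Newtonian operator $N:L^2(D)\to L^2(D)$ is $N(f)(x)=\int_D\frac{f(y)}{4\pi|x-y|}\,dy$. A sequence $\{p_n\}$ in a Hilbert space $\mathcal H$ is a Riesz basis if it is the image of an orthonormal basis under a bounded invertible linear operator on $\mathcal H$; equivalently, it is complete and there exist constants $0<\mathcal A\le\mathcal B$ with $\mathcal A\sum|c_n|^2\le\|\sum c_np_n\|^2\le\mathcal B\sum|c_n|^2$ for all finite scalar sequences $(c_n)$. *)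

theory Defs
  imports "HOL-Analysis.Analysis"
begin

definition L2 :: "'a::euclidean_space set \<Rightarrow> ('a \<Rightarrow> real) set" where
  "L2 S = {f. f \<in> borel_measurable (lebesgue_on S) \<and> integrable (lebesgue_on S) (\<lambda>x. (f x)^2)}"

definition L2norm2 :: "'a::euclidean_space set \<Rightarrow> ('a \<Rightarrow> real) \<Rightarrow> real" where
  "L2norm2 S f = (LINT x|lebesgue_on S. (f x)^2)"

definition riesz_basis :: "'a::euclidean_space set \<Rightarrow> ('i \<Rightarrow> 'a \<Rightarrow> real) \<Rightarrow> bool" where
  "riesz_basis S p \<longleftrightarrow>
     (\<forall>i. p i \<in> L2 S) \<and>
     (\<forall>g\<in>L2 S. \<forall>\<epsilon>>0. \<exists>F c. finite F \<and>
         L2norm2 S (\<lambda>x. g x - (\<Sum>i\<in>F. c i * p i x)) < \<epsilon>) \<and>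
     (\<exists>A B. 0 < A \<and> A \<le> B \<and>
        (\<forall>F (c :: 'i \<Rightarrow> real). finite F \<longrightarrow>
           A * (\<Sum>i\<in>F. (c i)^2) \<le> L2norm2 S (\<lambda>x. \<Sum>i\<in>F. c i * p i x) \<and>
           L2norm2 S (\<lambda>x. \<Sum>i\<in>F. c i * p i x) \<le> B * (\<Sum>i\<in>F. (c i)^2)))"

definition newton :: "(real^3) set \<Rightarrow> (real^3 \<Rightarrow> real) \<Rightarrow> real^3 \<Rightarrow> real" where
  "newton D f x = (LINT y|lebesgue_on D. f y / (4 * pi * norm (x - y)))"

definition newton_eig_mean :: "(real^3) set \<Rightarrow> real \<Rightarrow> bool" where
  "newton_eig_mean D \<mu> \<longleftrightarrow>
     (\<exists>e. e \<in> L2 D \<and> (AE x in lebesgue_on D. newton D e x = \<mu> * e x) \<and>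
          (LINT y|lebesgue_on D. e y) \<noteq> 0)"

end

theory Submission
  imports Defs
begin

text \<open>The Newtonian potential of a radial density \<open>h s / s\<close> on the ball is
  \<open>\<integral> h s * min r s / r ds\<close> at distance \<open>r\<close> from the center. Hence \<open>sin (k s) / s\<close> is mapped to
  \<open>1 / k\<^sup>2\<close> times itself minus \<open>cos (k a) / k\<close>, and testing an eigenfunction with nonzero mean against it
  shows, by symmetry of the operator, that the relevant eigenvalues are exactly \<open>1 / k\<^sup>2\<close> with
  \<open>k a = (n + 1/2) \<pi>\<close>. So \<open>\<omega>\<^sub>n = (n + 1/2) b\<close>, and the family is the half-integer
  trigonometric system, which is orthogonal with all squared norms equal to \<open>\<pi> / b\<close> and complete.\<close>

section \<open>Potentials of radial functions\<close>

text \<open>The eigenfunction \<open>e\<close> in \<open>newton_eig_mean\<close> is an arbitrary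
  \<open>L2\<close> function whose equation holds only almost everywhere, so it is neither radial
  nor regular a priori. Its equation is therefore used in integrated form: the operator is moved
  onto a radial test function, whose potential is explicit by Newton's shell theorem. That theorem
  comes from slicing each sphere by height along the axis through the field point: the height is
  uniformly distributed, so a surface integral becomes an integral over a chord.

  Completeness meets a different obstacle. The half-integer functions change sign under translation
  by 2 pi / b, and their span is not an algebra and has no constants, so Weierstrass approximation
  cannot act on the span itself. It acts on polynomials in cos(b t) multiplied by a half-angle
  factor. This reaches every product of sin(b t) with a continuous function, and such products are
  dense because this sine has only three zeros in the interval.\<close>

lemma distr_lborel_vec3:
  "distr (lborel :: (real^3) measure) borel (\<lambda>x. (x$1, x$2, x$3)) = lborel"
proof (rule lborel_eqI[symmetric])
  have [measurable]: "(\<lambda>x::real^3. (x$1, x$2, x$3)) \<in> borel \<rightarrow>\<^sub>M borel"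
    by (intro borel_measurable_continuous_onI continuous_intros)
  fix l u :: "real \<times> real \<times> real"
  assume le: "\<And>b. b \<in> Basis \<Longrightarrow> l \<bullet> b \<le> u \<bullet> b"
  obtain l1 l2 l3 u1 u2 u3 where lu: "l = (l1, l2, l3)" "u = (u1, u2, u3)"
    by (cases l, cases u) auto
  have le': "l1 \<le> u1" "l2 \<le> u2" "l3 \<le> u3"
    using le[of "(1,0,0)"] le[of "(0,1,0)"] le[of "(0,0,1)"]
    by (auto simp: lu Basis_prod_def zero_prod_def)
  have vimage: "(\<lambda>x::real^3. (x$1, x$2, x$3)) -` box l u = box (vector [l1, l2, l3]) (vector [u1, u2, u3])"
    by (auto simp: lu box_def Basis_prod_def mem_box_cart forall_3 Basis_vec_def inner_axis ball_Un)
  have basis: "(Basis :: (real^3) set) = (\<lambda>i. axis i 1) ` UNIV"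
    by (auto simp: Basis_vec_def)
  have inj: "inj (\<lambda>i::3. axis i (1::real))"
    by (auto intro!: injI simp: axis_eq_axis)
  have bp: "(Basis :: (real \<times> real \<times> real) set) = {(1,0,0),(0,1,0),(0,0,1)}"
    by (auto simp: Basis_prod_def zero_prod_def)
  have "emeasure (distr lborel borel (\<lambda>x::real^3. (x$1, x$2, x$3))) (box l u)
      = emeasure lborel (box (vector [l1, l2, l3]) (vector [u1, u2, u3]) :: (real^3) set)"
    by (simp add: emeasure_distr vimage)
  also have "\<dots> = ennreal (\<Prod>b\<in>Basis. (vector [u1, u2, u3] - vector [l1, l2, l3] :: real^3) \<bullet> b)"
    using le' by (subst emeasure_lborel_box_eq) (auto simp: basis inner_axis forall_3 inner_diff_left)
  also have "(\<Prod>b\<in>Basis. (vector [u1, u2, u3] - vector [l1, l2, l3] :: real^3) \<bullet> b)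
      = (\<Prod>i\<in>UNIV. (vector [u1, u2, u3] - vector [l1, l2, l3] :: real^3) $ i)"
    unfolding basis by (subst prod.reindex[OF inj]) (simp add: inner_axis o_def)
  also have "\<dots> = (u1 - l1) * (u2 - l2) * (u3 - l3)"
    unfolding UNIV_3 by (simp add: mult.assoc)
  also have "\<dots> = (\<Prod>b\<in>Basis. (u - l) \<bullet> b)"
    by (simp add: bp lu)
  finally show "emeasure (distr lborel borel (\<lambda>x::real^3. (x$1, x$2, x$3))) (box l u)
      = ennreal (\<Prod>b\<in>Basis. (u - l) \<bullet> b)" .
qed simp

text \<open>Serves to turn the axis from the centre of the ball to the field point into the first
  coordinate axis. Invariance is known for images of sets, so the preimage of a box is read as its
  image under the inverse map, which is orthogonal too.\<close>

lemma distr_lborel_orthogonal: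
  fixes f :: "real^'n::{finite,wellorder} \<Rightarrow> real^'n::_"
  assumes f: "orthogonal_transformation f"
  shows "distr lborel borel f = lborel"
proof (rule lborel_eqI[symmetric])
  have [measurable]: "f \<in> borel \<rightarrow>\<^sub>M borel"
    using f by (intro borel_measurable_continuous_onI linear_continuous_on)
      (simp add: orthogonal_transformation_linear linear_conv_bounded_linear[symmetric])
  fix l u :: "real^'n::{finite,wellorder}"
  assume le: "\<And>b. b \<in> Basis \<Longrightarrow> l \<bullet> b \<le> u \<bullet> b"
  have invf: "orthogonal_transformation (inv f)"
    using f by (rule orthogonal_transformation_inv)
  have vimage: "f -` box l u = inv f ` box l u"
    using orthogonal_transformation_bij[OF f] by (rule bij_vimage_eq_inv_image)
  have "open (f -` box l u)"
    using f by (intro open_vimage linear_continuous_on)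
      (auto simp: orthogonal_transformation_linear linear_conv_bounded_linear[symmetric])
  then have borel: "f -` box l u \<in> sets borel"
    by simp
  have lm: "inv f ` box l u \<in> lmeasurable"
    using invf by (rule measurable_orthogonal_image) auto
  have "emeasure (distr lborel borel f) (box l u) = emeasure lborel (f -` box l u)"
    by (simp add: emeasure_distr)
  also have "\<dots> = emeasure lebesgue (inv f ` box l u)"
    using borel by (simp add: vimage)
  also have "\<dots> = ennreal (measure lebesgue (inv f ` box l u))"
    using lm by (simp add: emeasure_eq_measure2)
  also have "measure lebesgue (inv f ` box l u) = measure lebesgue (box l u)"
    using invf by (rule measure_orthogonal_image) auto
  also have "ennreal \<dots> = (\<Prod>b\<in>Basis. (u - l) \<bullet> b)"
    using le by (simp add: measure_lborel_box_eq)
  finally show "emeasure (distr lborel borel f) (box l u) = (\<Prod>b\<in>Basis. (u - l) \<bullet> b)" .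
qed simp

text \<open>A disc of squared radius c has area pi c, linear in c, so the squared radius has
  constant density pi. Half-lines generate the Borel sets and settle the equality. Working with the
  square replaces polar coordinates in the plane.\<close>

lemma distr_lborel_norm_square_plane:
  "distr (lborel :: (real \<times> real) measure) borel (\<lambda>p. (norm p)\<^sup>2)
     = density lborel (\<lambda>u. ennreal pi * indicator {0..} u)" (is "?M = ?N")
proof (rule measure_eqI_generator_eq[where \<Omega> = UNIV and E = "range (\<lambda>c::real. {..c})"
      and A = "\<lambda>n. {..real n}"])
  have eq: "emeasure ?M {..c} = ennreal (pi * max 0 c)"
       "emeasure ?N {..c} = ennreal (pi * max 0 c)" for c
  proof -
    have "emeasure ?M {..c} = emeasure lborel ((\<lambda>p::real\<times>real. (norm p)\<^sup>2) -` {..c})"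
      by (subst emeasure_distr) auto
    also have "\<dots> = ennreal (pi * max 0 c)"
    proof (cases "c \<ge> 0")
      case True
      then have "(\<lambda>p::real\<times>real. (norm p)\<^sup>2) -` {..c} = cball 0 (sqrt c)"
        using power_mono[of "norm p" "sqrt c" 2 for p :: "real \<times> real"] by (auto intro: real_le_rsqrt)
      then show ?thesis
        using True emeasure_cball[of "sqrt c" "0::real\<times>real"]
        by (simp add: unit_ball_vol_2)
    next
      case False
      then have "\<not> (norm p)\<^sup>2 \<le> c" for p :: "real \<times> real"
        by (meson order_trans zero_le_power2)
      then have "(\<lambda>p::real\<times>real. (norm p)\<^sup>2) -` {..c} = {}"
        by blast
      then show ?thesis using False by simp
    qed
    finally show "emeasure ?M {..c} = ennreal (pi * max 0 c)" .
    have "emeasure ?N {..c} = (\<integral>\<^sup>+u. ennreal pi * indicator {0..c} u \<partial>lborel)"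
      by (subst emeasure_density) (auto intro!: nn_integral_cong split: split_indicator)
    also have "\<dots> = ennreal (pi * max 0 c)"
      by (cases "c \<ge> 0") (auto simp: nn_integral_cmult ennreal_mult' max_def)
    finally show "emeasure ?N {..c} = ennreal (pi * max 0 c)" .
  qed
  show "Int_stable (range (\<lambda>c::real. {..c}))"
    by (auto simp: Int_stable_def)
  show "sets ?M = sigma_sets UNIV (range (\<lambda>c::real. {..c}))"
       "sets ?N = sigma_sets UNIV (range (\<lambda>c::real. {..c}))"
    by (simp_all add: borel_eq_atMost)
  show "\<Union> (range (\<lambda>n. {..real n})) = UNIV"
    by (auto intro: real_arch_simple)
  show "emeasure ?M X = emeasure ?N X" if "X \<in> range (\<lambda>c::real. {..c})" for X
    using that by (auto simp: eq)
  show "emeasure ?M {..real n} \<noteq> \<infinity>" for n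
    by (simp add: eq)
qed auto

text \<open>Cylindrical coordinates \<open>t = y $ 1\<close>, \<open>v = (norm y)\<^sup>2\<close>: the plane area element in terms of the
  squared radius \<open>v - t\<^sup>2\<close> is \<open>\<pi> dv\<close>.\<close>

lemma nn_integral_axial:
  fixes F :: "real \<Rightarrow> real \<Rightarrow> ennreal"
  assumes F[measurable]: "case_prod F \<in> borel_measurable (borel \<Otimes>\<^sub>M borel)"
  shows "(\<integral>\<^sup>+y. F (y$1) ((norm y)\<^sup>2) \<partial>(lborel :: (real^3) measure))
    = (\<integral>\<^sup>+v. \<integral>\<^sup>+t. pi * (indicator {t\<^sup>2..} v * F t v) \<partial>lborel \<partial>lborel)"
proof -
  have n3: "(norm y)\<^sup>2 = (y$1)\<^sup>2 + (norm (y$2, y$3))\<^sup>2" for y :: "real^3"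
    by (simp add: norm_vec_def L2_set_def sum_3 norm_Pair)
  have [measurable]: "(\<lambda>x::real^3. (x$1, x$2, x$3)) \<in> borel \<rightarrow>\<^sub>M borel"
    by (intro borel_measurable_continuous_onI continuous_intros)
  have Fm[measurable]: "(\<lambda>x. F (f x) (g x)) \<in> borel_measurable M"
    if "f \<in> borel_measurable M" "g \<in> borel_measurable M" for f g and M :: "'a measure"
    using measurable_compose[OF measurable_Pair[OF that] F] by simp
  have Fm2[measurable]: "F t \<in> borel_measurable borel" for t
    by (rule Fm) auto
  have [measurable]: "(\<lambda>q. F (fst q) ((fst q)\<^sup>2 + (norm (snd q))\<^sup>2)) \<in> borel_measurable (borel :: (real \<times> real \<times> real) measure)"
    by (intro Fm; intro borel_measurable_continuous_onI continuous_intros)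
  have "(\<integral>\<^sup>+y. F (y$1) ((norm y)\<^sup>2) \<partial>(lborel :: (real^3) measure))
     = (\<integral>\<^sup>+q. F (fst q) ((fst q)\<^sup>2 + (norm (snd q))\<^sup>2) \<partial>distr (lborel::(real^3) measure) borel (\<lambda>x. (x$1, x$2, x$3)))"
    by (subst nn_integral_distr)
       (auto simp: n3)
  also have "\<dots> = (\<integral>\<^sup>+q. F (fst q) ((fst q)\<^sup>2 + (norm (snd q))\<^sup>2) \<partial>(lborel \<Otimes>\<^sub>M (lborel :: (real \<times> real) measure)))"
    by (simp add: distr_lborel_vec3 lborel_prod)
  also have "\<dots> = (\<integral>\<^sup>+t. \<integral>\<^sup>+p. F t (t\<^sup>2 + (norm p)\<^sup>2) \<partial>(lborel :: (real \<times> real) measure) \<partial>lborel)"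
    by (subst lborel.nn_integral_fst[symmetric]) auto
  also have "\<dots> = (\<integral>\<^sup>+t. \<integral>\<^sup>+u. F t (t\<^sup>2 + u) \<partial>distr (lborel :: (real \<times> real) measure) borel (\<lambda>p. (norm p)\<^sup>2) \<partial>lborel)"
    by (subst nn_integral_distr) auto
  also have "\<dots> = (\<integral>\<^sup>+t. \<integral>\<^sup>+u. pi * (indicator {0..} u * F t (t\<^sup>2 + u)) \<partial>lborel \<partial>lborel)"
    unfolding distr_lborel_norm_square_plane by (subst nn_integral_density) (auto simp: mult.assoc)
  also have "\<dots> = (\<integral>\<^sup>+t. \<integral>\<^sup>+v. pi * (indicator {t\<^sup>2..} v * F t v) \<partial>lborel \<partial>lborel)"
  proof (rule nn_integral_cong)
    fix t :: real
    have "(\<integral>\<^sup>+v. pi * (indicator {t\<^sup>2..} v * F t v) \<partial>lborel)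
       = ennreal \<bar>1\<bar> * (\<integral>\<^sup>+u. pi * (indicator {t\<^sup>2..} (t\<^sup>2 + 1 * u) * F t (t\<^sup>2 + 1 * u)) \<partial>lborel)"
      by (rule nn_integral_real_affine) auto
    then show "(\<integral>\<^sup>+u. pi * (indicator {0..} u * F t (t\<^sup>2 + u)) \<partial>lborel)
        = (\<integral>\<^sup>+v. pi * (indicator {t\<^sup>2..} v * F t v) \<partial>lborel)"
      by (auto intro!: nn_integral_cong split: split_indicator)
  qed
  \<comment> \<open>With \<open>v\<close> outermost, the inner integral belongs to a single sphere
    of radius sqrt v, and its height t runs over the chord from - sqrt v to sqrt v.\<close>
  also have "\<dots> = (\<integral>\<^sup>+v. \<integral>\<^sup>+t. pi * (indicator {t\<^sup>2..} v * F t v) \<partial>lborel \<partial>lborel)"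
    by (rule lborel_pair.Fubini') (unfold atLeast_def indicator_def, auto simp: mem_Collect_eq)
  finally show ?thesis .
qed

text \<open>\<open>J s\<close> is the integral of the weight over the heights of the sphere of
  radius s. The factor 2 pi s combines pi from the plane density with the derivative of v = s^2. The
  chord formula is asked for almost every \<open>v\<close> only, because the Newtonian kernel is
  singular on the sphere through the field point.\<close>

lemma nn_integral_radial:
  fixes h J :: "real \<Rightarrow> real" and w :: "real \<Rightarrow> real \<Rightarrow> ennreal"
  assumes h[measurable]: "h \<in> borel_measurable borel" and h0: "\<And>s. 0 \<le> h s"
    and w[measurable]: "case_prod w \<in> borel_measurable (borel \<Otimes>\<^sub>M borel)"
    and J[measurable]: "J \<in> borel_measurable borel" and J0: "\<And>s. 0 \<le> s \<Longrightarrow> 0 \<le> J s"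
    and inner: "AE v in lborel. 0 \<le> v \<longrightarrow>
      (\<integral>\<^sup>+t. indicator {t\<^sup>2..} v * w t v \<partial>lborel) = ennreal (J (sqrt v))"
    and R: "0 \<le> R"
  shows "(\<integral>\<^sup>+y. indicator {..R} (norm y) * ennreal (h (norm y)) * w (y$1) ((norm y)\<^sup>2) \<partial>(lborel :: (real^3) measure))
    = (\<integral>\<^sup>+s. ennreal (h s * (2 * pi * s * J s) * indicator {0..R} s) \<partial>lborel)"
proof -
  have wm[measurable]: "(\<lambda>x. w (f x) (g x)) \<in> borel_measurable M"
    if "f \<in> borel_measurable M" "g \<in> borel_measurable M" for f g and M :: "'a measure"
    using measurable_compose[OF measurable_Pair[OF that] w] by simp
  define F where "F t v = indicator {..R} (sqrt v) * ennreal (h (sqrt v)) * w t v" for t v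
  have Fm: "case_prod F \<in> borel_measurable (borel \<Otimes>\<^sub>M borel)"
    unfolding F_def by measurable
  have "(\<integral>\<^sup>+y. indicator {..R} (norm y) * ennreal (h (norm y)) * w (y$1) ((norm y)\<^sup>2) \<partial>(lborel :: (real^3) measure))
      = (\<integral>\<^sup>+y. F (y$1) ((norm y)\<^sup>2) \<partial>(lborel :: (real^3) measure))"
    by (simp add: F_def)
  also have "\<dots> = (\<integral>\<^sup>+v. \<integral>\<^sup>+t. pi * (indicator {t\<^sup>2..} v * F t v) \<partial>lborel \<partial>lborel)"
    by (rule nn_integral_axial[OF Fm])
  also have "\<dots> = (\<integral>\<^sup>+v. \<integral>\<^sup>+t. (ennreal pi * indicator {..R} (sqrt v) * ennreal (h (sqrt v))) * (indicator {t\<^sup>2..} v * w t v) \<partial>lborel \<partial>lborel)"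
    by (intro nn_integral_cong) (simp add: F_def mult_ac)
  also have "\<dots> = (\<integral>\<^sup>+v. (ennreal pi * indicator {..R} (sqrt v) * ennreal (h (sqrt v))) * (\<integral>\<^sup>+t. indicator {t\<^sup>2..} v * w t v \<partial>lborel) \<partial>lborel)"
    by (intro nn_integral_cong nn_integral_cmult) (unfold atLeast_def indicator_def, auto simp: mem_Collect_eq)
  also have "\<dots> = (\<integral>\<^sup>+v. ennreal (h (sqrt v) * (pi * J (sqrt v)) * indicator {0\<^sup>2..R\<^sup>2} v) \<partial>lborel)"
  proof (rule nn_integral_cong_AE)
    show "AE v in lborel. ennreal pi * indicator {..R} (sqrt v) * ennreal (h (sqrt v)) * (\<integral>\<^sup>+t. indicator {t\<^sup>2..} v * w t v \<partial>lborel)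
       = ennreal (h (sqrt v) * (pi * J (sqrt v)) * indicator {0\<^sup>2..R\<^sup>2} v)"
      using inner
    proof eventually_elim
      case (elim v)
      show ?case
      proof (cases "v \<ge> 0")
        case True
        have "sqrt v \<le> R \<longleftrightarrow> v \<le> R\<^sup>2"
          using R True by (metis real_sqrt_le_iff real_sqrt_unique real_sqrt_abs abs_of_nonneg)
        with True elim show ?thesis
          by (auto simp: ennreal_mult'[symmetric] h0 J0 mult_ac split: split_indicator)
      next
        case False
        then have "indicator {t\<^sup>2..} v = (0::ennreal)" for t
          using order_trans[of 0 "t\<^sup>2" v] by (auto simp: indicator_def)
        then show ?thesis using False by simp
      qed
    qed
  qed
  also have "\<dots> = (\<integral>\<^sup>+s. ennreal (h (sqrt (s\<^sup>2)) * (pi * J (sqrt (s\<^sup>2))) * (2 * s) * indicator {0..R} s) \<partial>lborel)"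
    using R by (intro nn_integral_substitution[where g = "\<lambda>s. s\<^sup>2" and g' = "\<lambda>s. 2 * s"])
      (auto simp: set_borel_measurable_def intro!: derivative_eq_intros continuous_intros)
  also have "\<dots> = (\<integral>\<^sup>+s. ennreal (h s * (2 * pi * s * J s) * indicator {0..R} s) \<partial>lborel)"
    by (intro nn_integral_cong) (auto simp: mult_ac split: split_indicator)
  finally show ?thesis .
qed

text \<open>\<open>nn_integral_radial\<close> with \<open>h\<close> the indicator of a Borel set. In
  the form of a pushforward measure it lets densities of either sign be integrated later, without
  splitting them into positive and negative parts.\<close>

lemma distr_norm_radial:
  fixes J :: "real \<Rightarrow> real" and w :: "real \<Rightarrow> real \<Rightarrow> ennreal"
  assumes w[measurable]: "case_prod w \<in> borel_measurable (borel \<Otimes>\<^sub>M borel)"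
    and J[measurable]: "J \<in> borel_measurable borel" and J0: "\<And>s. 0 \<le> s \<Longrightarrow> 0 \<le> J s"
    and inner: "AE v in lborel. 0 \<le> v \<longrightarrow>
      (\<integral>\<^sup>+t. indicator {t\<^sup>2..} v * w t v \<partial>lborel) = ennreal (J (sqrt v))"
    and a: "0 \<le> a"
  shows "distr (density lborel (\<lambda>y::real^3. indicator (ball 0 a) y * w (y$1) ((norm y)\<^sup>2))) borel norm
    = density lborel (\<lambda>s. ennreal (indicator {0..a} s * (2 * pi * s * J s)))" (is "?M = ?N")
proof (rule measure_eqI)
  show "sets ?M = sets ?N" by simp
  have wm[measurable]: "(\<lambda>x. w (f x) (g x)) \<in> borel_measurable M"
    if "f \<in> borel_measurable M" "g \<in> borel_measurable M" for f g and M :: "'a measure"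
    using measurable_compose[OF measurable_Pair[OF that] w] by simp
  fix A assume "A \<in> sets ?M"
  then have [measurable]: "A \<in> sets borel" by simp
  have [measurable]: "norm -` A \<in> sets (borel :: (real^3) measure)"
    by (rule measurable_sets_borel[OF borel_measurable_norm]) auto
  have [measurable]: "ball (0 :: real^3) a \<in> sets borel"
    by simp
  have "emeasure ?M A = (\<integral>\<^sup>+y. indicator (ball 0 a) y * w (y$1) ((norm y)\<^sup>2) * indicator (norm -` A) y \<partial>(lborel :: (real^3) measure))"
    by (simp add: emeasure_distr emeasure_density)
  \<comment> \<open>The ball is open, hence the cut at \<open>{..<a}\<close>. The radius
    \<open>a\<close> itself is put back below as a single point of measure zero.\<close>
  also have "\<dots> = (\<integral>\<^sup>+y. indicator {..a} (norm y) * ennreal (indicator (A \<inter> {..<a}) (norm y)) * w (y$1) ((norm y)\<^sup>2) \<partial>(lborel :: (real^3) measure))"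
    by (intro nn_integral_cong) (auto split: split_indicator)
  also have "\<dots> = (\<integral>\<^sup>+s. ennreal (indicator (A \<inter> {..<a}) s * (2 * pi * s * J s) * indicator {0..a} s) \<partial>lborel)"
    by (rule nn_integral_radial) (use assms in auto)
  also have "\<dots> = (\<integral>\<^sup>+s. ennreal (indicator {0..a} s * (2 * pi * s * J s)) * indicator A s \<partial>lborel)"
  proof (rule nn_integral_cong_AE)
    show "AE s in lborel. ennreal (indicator (A \<inter> {..<a}) s * (2 * pi * s * J s) * indicator {0..a} s)
       = ennreal (indicator {0..a} s * (2 * pi * s * J s)) * indicator A s"
      using AE_lborel_singleton[of a] by eventually_elim (auto split: split_indicator)
  qed
  also have "\<dots> = emeasure ?N A"
    by (subst emeasure_density) auto
  finally show "emeasure ?M A = emeasure ?N A" .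
qed

text \<open>The shell theorem. By the law of cosines the root is the distance from the axis point at
  distance \<open>r\<close> to a point at height t on the sphere of radius q = sqrt v. Up to the
  factor - 1 / (4 pi r) this root is its own primitive, and the end values give (r + q) - |r - q|,
  which is 2 min r q. Excluding v = r^2 keeps the radicand positive up to the end t = q.\<close>

lemma nn_integral_inverse_dist_chord:
  fixes r v :: real
  assumes r: "0 < r" and v: "0 \<le> v" and ne: "v \<noteq> r\<^sup>2"
  shows "(\<integral>\<^sup>+t. indicator {t\<^sup>2..} v * ennreal (1 / (4 * pi * sqrt (r\<^sup>2 - 2 * r * t + v))) \<partial>lborel)
     = ennreal (min r (sqrt v) / (2 * pi * r))"
proof -
  define q where "q = sqrt v"
  have q: "0 \<le> q" "v = q\<^sup>2" "q \<noteq> r"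
    using v ne by (auto simp: q_def)
  have t: "t\<^sup>2 \<le> v \<longleftrightarrow> -q \<le> t \<and> t \<le> q" for t
    using q abs_le_square_iff[of t q] by auto
  have pos: "0 < r\<^sup>2 - 2 * r * t + v" if "t \<le> q" for t
  proof -
    have "0 < (r - q)\<^sup>2" using q by simp
    also have "\<dots> = r\<^sup>2 - 2 * r * q + v" by (simp add: q power2_eq_square algebra_simps)
    also have "\<dots> \<le> r\<^sup>2 - 2 * r * t + v" using r that by simp
    finally show ?thesis .
  qed
  let ?f = "\<lambda>t. 1 / (4 * pi * sqrt (r\<^sup>2 - 2 * r * t + v))"
  let ?F = "\<lambda>t. - sqrt (r\<^sup>2 - 2 * r * t + v) / (4 * pi * r)"
  have "(\<integral>\<^sup>+t. indicator {t\<^sup>2..} v * ennreal (?f t) \<partial>lborel)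
      = (\<integral>\<^sup>+t. ennreal (?f t) * indicator {-q..q} t \<partial>lborel)"
    by (intro nn_integral_cong) (auto simp: t split: split_indicator)
  also have "\<dots> = ?F q - ?F (-q)"
  proof (rule nn_integral_FTC_Icc)
    show "DERIV ?F t :> ?f t" if "t \<in> {-q..q}" for t
      using r pos[of t] that
      by (auto intro!: derivative_eq_intros simp: divide_simps)
    show "0 \<le> ?f t" if "t \<in> {-q..q}" for t
      using pos[of t] that by simp
  qed (use q in auto)
  also have "?F q - ?F (-q) = (sqrt ((r + q)\<^sup>2) - sqrt ((r - q)\<^sup>2)) / (4 * pi * r)"
    by (simp add: q power2_sum power2_diff diff_divide_distrib algebra_simps)
  also have "\<dots> = min r q / (2 * pi * r)"
    using r q(1) by (auto simp: min_def field_simps)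
  finally show ?thesis by (simp add: q_def)
qed

text \<open>The weight 1 in \<open>distr_norm_radial\<close>: a chord has length 2 sqrt v, so
  \<open>J s\<close> = 2 s and the density is the area of a sphere. It yields the mean of the
  explicit eigenfunctions.\<close>

lemma distr_norm_ball:
  assumes "0 \<le> a"
  shows "distr (density lborel (\<lambda>y::real^3. indicator (ball z a) y)) borel (\<lambda>y. norm (y - z))
    = density lborel (\<lambda>s. ennreal (indicator {0..a} s * (4 * pi * s\<^sup>2)))"
proof -
  have [measurable]: "ball z a \<in> sets borel"
    by simp
  have "distr (density lborel (\<lambda>y::real^3. indicator (ball z a) y)) borel (\<lambda>y. norm (y - z))
      = distr (density (distr lborel borel ((+) z)) (\<lambda>y. indicator (ball z a) y)) borel (\<lambda>y. norm (y - z))"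
    by (simp only: lborel_distr_plus)
  also have "\<dots> = distr (distr (density lborel (\<lambda>y. indicator (ball z a) (z + y))) borel ((+) z)) borel (\<lambda>y. norm (y - z))"
    by (subst density_distr) (auto intro: borel_measurable_indicator)
  also have "\<dots> = distr (density lborel (\<lambda>y. indicator (ball z a) (z + y))) borel ((\<lambda>y. norm (y - z)) \<circ> (+) z)"
    by (subst distr_distr) auto
  also have "\<dots> = distr (density lborel (\<lambda>y::real^3. indicator (ball 0 a) y * 1)) borel norm"
    by (simp add: o_def indicator_def dist_norm)
  also have "\<dots> = density lborel (\<lambda>s. ennreal (indicator {0..a} s * (2 * pi * s * (2 * s))))"
  proof (rule distr_norm_radial)
    have "(\<integral>\<^sup>+t. indicator {t\<^sup>2..} v * 1 \<partial>lborel) = ennreal (2 * sqrt v)" if "0 \<le> v" for v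
    proof -
      have t: "t\<^sup>2 \<le> v \<longleftrightarrow> - sqrt v \<le> t \<and> t \<le> sqrt v" for t
        using that abs_le_square_iff[of t "sqrt v"] by auto
      have "(\<integral>\<^sup>+t. indicator {t\<^sup>2..} v * 1 \<partial>lborel) = (\<integral>\<^sup>+t. indicator {-sqrt v..sqrt v} t \<partial>lborel)"
        by (intro nn_integral_cong) (auto simp: t split: split_indicator)
      then show ?thesis using that by simp
    qed
    then show "AE v in lborel. 0 \<le> v \<longrightarrow> (\<integral>\<^sup>+t. indicator {t\<^sup>2..} v * 1 \<partial>lborel) = ennreal (2 * sqrt v)"
      by auto
  qed (use assms in auto)
  also have "\<dots> = density lborel (\<lambda>s. ennreal (indicator {0..a} s * (4 * pi * s\<^sup>2)))"
    by (intro arg_cong[where f="density lborel"] ext) (simp add: power2_eq_square mult_ac)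
  finally show ?thesis .
qed

text \<open>The substitution of z + f y for y, with \<open>f\<close> a rotation sending r times the
  first axis vector to \<open>x - z\<close>, puts the field point on the axis. The kernel then
  depends only on height and norm, and the shell theorem supplies \<open>J\<close>.\<close>

lemma distr_norm_newton_kernel:
  fixes x z :: "real^3"
  assumes a: "0 \<le> a" and xz: "x \<noteq> z"
  defines "r \<equiv> norm (x - z)"
  shows "distr (density lborel (\<lambda>y. indicator (ball z a) y * ennreal (1 / (4 * pi * norm (x - y))))) borel (\<lambda>y. norm (y - z))
    = density lborel (\<lambda>s. ennreal (indicator {0..a} s * (s * min r s / r)))"
proof -
  have [measurable]: "ball z a \<in> sets borel"
    by simp
  have r: "0 < r" using xz by (simp add: r_def)
  obtain f :: "real^3 \<Rightarrow> real^3" where f: "orthogonal_transformation f" and fx: "f (r *\<^sub>R axis 1 1) = x - z"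
    using orthogonal_transformation_exists[of "r *\<^sub>R axis 1 1" "x - z"] r by (auto simp: r_def)
  have lin: "linear f" using f by (rule orthogonal_transformation_linear)
  have fm[measurable]: "f \<in> borel \<rightarrow>\<^sub>M borel"
    using lin by (intro borel_measurable_continuous_onI linear_continuous_on)
      (simp add: linear_conv_bounded_linear[symmetric])
  have "distr lborel borel (\<lambda>y. z + f y) = distr (distr lborel borel f) borel ((+) z)"
    by (subst distr_distr) (auto simp: o_def)
  then have T: "distr lborel borel (\<lambda>y. z + f y) = lborel"
    by (simp add: distr_lborel_orthogonal[OF f] lborel_distr_plus)
  have nf: "norm (f y) = norm y" for y
    using f by (rule orthogonal_transformation_norm)
  have dist: "norm (x - (z + f y)) = sqrt (r\<^sup>2 - 2 * r * y$1 + (norm y)\<^sup>2)" for y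
  proof -
    have "x - (z + f y) = f (r *\<^sub>R axis 1 1 - y)"
      using fx by (simp add: linear_diff[OF lin] algebra_simps)
    then have "norm (x - (z + f y)) = norm (r *\<^sub>R axis 1 1 - y)"
      by (simp add: nf)
    also have "\<dots> = sqrt ((norm (r *\<^sub>R axis 1 1 - y))\<^sup>2)" by simp
    also have "(norm (r *\<^sub>R axis 1 1 - y))\<^sup>2 = r\<^sup>2 - 2 * r * y$1 + (norm y)\<^sup>2"
      unfolding power2_norm_eq_inner
      by (simp add: inner_diff_left inner_diff_right inner_axis inner_axis'
         inner_commute power2_eq_square algebra_simps)
    finally show ?thesis .
  qed
  let ?\<phi> = "\<lambda>y. indicator (ball z a) y * ennreal (1 / (4 * pi * norm (x - y)))"
  let ?w = "\<lambda>t v. ennreal (1 / (4 * pi * sqrt (r\<^sup>2 - 2 * r * t + v)))"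
  have "distr (density lborel ?\<phi>) borel (\<lambda>y. norm (y - z))
      = distr (density (distr lborel borel (\<lambda>y. z + f y)) ?\<phi>) borel (\<lambda>y. norm (y - z))"
    by (simp only: T)
  also have "\<dots> = distr (distr (density lborel (\<lambda>y. ?\<phi> (z + f y))) borel (\<lambda>y. z + f y)) borel (\<lambda>y. norm (y - z))"
    by (subst density_distr) (auto intro: borel_measurable_indicator)
  also have "\<dots> = distr (density lborel (\<lambda>y. ?\<phi> (z + f y))) borel ((\<lambda>y. norm (y - z)) \<circ> (\<lambda>y. z + f y))"
    by (subst distr_distr) auto
  also have "\<dots> = distr (density lborel (\<lambda>y::real^3. indicator (ball 0 a) y * ?w (y$1) ((norm y)\<^sup>2))) borel norm"
    by (simp add: o_def dist indicator_def dist_norm nf)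
  also have "\<dots> = density lborel (\<lambda>s. ennreal (indicator {0..a} s * (2 * pi * s * (min r s / (2 * pi * r)))))"
  proof (rule distr_norm_radial)
    show "AE v in lborel. 0 \<le> v \<longrightarrow> (\<integral>\<^sup>+t. indicator {t\<^sup>2..} v * ?w t v \<partial>lborel) = ennreal (min r (sqrt v) / (2 * pi * r))"
      using AE_lborel_singleton[of "r\<^sup>2"]
      by eventually_elim (use nn_integral_inverse_dist_chord[OF r] in auto)
  qed (use a r in auto)
  also have "\<dots> = density lborel (\<lambda>s. ennreal (indicator {0..a} s * (s * min r s / r)))"
    by simp
  finally show ?thesis .
qed

section \<open>Potentials and means of radial densities, and symmetry of the operator\<close>

lemma lebesgue_on_eq_distr:
  fixes S :: "'a::euclidean_space set" and f :: "'a \<Rightarrow> real"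
  assumes S: "S \<in> sets borel" and f: "f \<in> borel_measurable borel"
  shows "(LINT x|lebesgue_on S. f x) = (LINT x|lborel. indicator S x * f x)"
proof -
  have "(LINT x|lebesgue_on S. f x) = (LINT x|lebesgue. indicator S x *\<^sub>R f x)"
    using S by (subst integral_restrict_space) auto
  also have "\<dots> = (LINT x|lborel. indicator S x *\<^sub>R f x)"
    using S f by (intro integral_completion) auto
  finally show ?thesis by simp
qed

lemma integral_Icc_lborel:
  fixes f :: "real \<Rightarrow> real"
  assumes "continuous_on {a..b} f"
  shows "(LINT s|lborel. indicator {a..b} s * f s) = integral {a..b} f"
proof -
  have "(LINT s:{a..b}|lborel. f s) = integral {a..b} f"
    using assms by (intro set_borel_integral_eq_integral borel_integrable_atLeastAtMost')
  then show ?thesis by (simp add: set_lebesgue_integral_def)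
qed

lemma has_integral_DERIV:
  fixes F f :: "real \<Rightarrow> real"
  assumes "a \<le> b" "\<And>x. (F has_real_derivative f x) (at x)"
  shows "(f has_integral F b - F a) {a..b}"
  using assms by (intro fundamental_theorem_of_calculus)
    (simp_all add: has_real_derivative_iff_has_vector_derivative[symmetric] has_field_derivative_at_within)

text \<open>The density is written as h(s) / s so that one factor s of the kernel measure cancels
  and leaves h(s) min(r, s) / r. Shells inside radius \<open>r\<close> act as if concentrated at the
  centre and give the \<open>G\<^sub>1\<close> term; shells outside have constant potential and give
  the \<open>G\<^sub>2\<close> term.\<close>

lemma newton_radial:
  fixes x z :: "real^3" and h G\<^sub>1 G\<^sub>2 :: "real \<Rightarrow> real"
  assumes x: "x \<in> ball z a" "x \<noteq> z"
    and h: "continuous_on UNIV h"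
    and G1: "\<And>s. (G\<^sub>1 has_real_derivative s * h s) (at s)"
    and G2: "\<And>s. (G\<^sub>2 has_real_derivative h s) (at s)"
  defines "r \<equiv> norm (x - z)"
  shows "newton (ball z a) (\<lambda>y. h (norm (y - z)) / norm (y - z)) x
     = (G\<^sub>1 r - G\<^sub>1 0) / r + G\<^sub>2 a - G\<^sub>2 r"
proof -
  have r: "0 < r" "r < a"
    using x by (auto simp: r_def dist_norm norm_minus_commute)
  have [measurable]: "h \<in> borel_measurable borel" "ball z a \<in> sets borel"
    using h by (auto intro: borel_measurable_continuous_onI)
  let ?k = "\<lambda>y. indicator (ball z a) y * (1 / (4 * pi * norm (x - y)))"
  have ke: "ennreal (?k y) = indicator (ball z a) y * ennreal (1 / (4 * pi * norm (x - y)))" for y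
    by (auto split: split_indicator)
  have "newton (ball z a) (\<lambda>y. h (norm (y - z)) / norm (y - z)) x
      = (LINT y|lborel. ?k y *\<^sub>R (h (norm (y - z)) / norm (y - z)))"
    unfolding newton_def by (subst lebesgue_on_eq_distr) (auto simp: mult_ac)
  also have "\<dots> = (LINT y|density lborel ?k. h (norm (y - z)) / norm (y - z))"
    by (subst integral_density) auto
  also have "\<dots> = (LINT s|distr (density lborel ?k) borel (\<lambda>y. norm (y - z)). h s / s)"
    by (subst integral_distr) auto
  also have "\<dots> = (LINT s|density lborel (\<lambda>s. ennreal (indicator {0..a} s * (s * min r s / r))). h s / s)"
    unfolding ke using distr_norm_newton_kernel[of a x z] x r by (simp add: r_def)
  also have "\<dots> = (LINT s|lborel. (indicator {0..a} s * (s * min r s / r)) *\<^sub>R (h s / s))"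
    using r by (intro integral_density) (auto split: split_indicator)
  also have "\<dots> = (LINT s|lborel. indicator {0..a} s * (h s * min r s / r))"
    using r by (intro Bochner_Integration.integral_cong) (auto split: split_indicator)
  also have "\<dots> = integral {0..a} (\<lambda>s. h s * min r s / r)"
    using r h by (intro integral_Icc_lborel continuous_intros) (auto intro: continuous_on_subset)
  also have "\<dots> = (G\<^sub>1 r - G\<^sub>1 0) / r + (G\<^sub>2 a - G\<^sub>2 r)"
  proof (rule integral_unique, rule has_integral_combine)
    have "((\<lambda>s. s * h s / r) has_integral G\<^sub>1 r / r - G\<^sub>1 0 / r) {0..r}"
      using r by (intro has_integral_DERIV DERIV_cdivide G1) auto
    then show "((\<lambda>s. h s * min r s / r) has_integral (G\<^sub>1 r - G\<^sub>1 0) / r) {0..r}"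
      by (subst has_integral_cong[where g = "\<lambda>s. s * h s / r"]) (auto simp: min_def diff_divide_distrib)
    have "(h has_integral G\<^sub>2 a - G\<^sub>2 r) {r..a}"
      using r by (intro has_integral_DERIV G2) auto
    then show "((\<lambda>s. h s * min r s / r) has_integral G\<^sub>2 a - G\<^sub>2 r) {r..a}"
      using r by (subst has_integral_cong[where g = h]) (auto simp: min_def)
  qed (use r in auto)
  finally show ?thesis by simp
qed

lemma integral_ball_radial:
  fixes z :: "real^3" and h G :: "real \<Rightarrow> real"
  assumes a: "0 < a"
    and h: "continuous_on UNIV h"
    and G: "\<And>s. (G has_real_derivative s * h s) (at s)"
  shows "(LINT y|lebesgue_on (ball z a). h (norm (y - z)) / norm (y - z)) = 4 * pi * (G a - G 0)"
proof -
  have [measurable]: "h \<in> borel_measurable borel" "ball z a \<in> sets borel"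
    using h by (auto intro: borel_measurable_continuous_onI)
  have ke: "ennreal (indicator (ball z a) y) = indicator (ball z a) y" for y
    by (auto split: split_indicator)
  have "(LINT y|lebesgue_on (ball z a). h (norm (y - z)) / norm (y - z))
      = (LINT y|lborel. indicator (ball z a) y *\<^sub>R (h (norm (y - z)) / norm (y - z)))"
    by (subst lebesgue_on_eq_distr) auto
  also have "\<dots> = (LINT y|density lborel (indicator (ball z a) :: _ \<Rightarrow> real). h (norm (y - z)) / norm (y - z))"
    by (subst integral_density) auto
  also have "\<dots> = (LINT s|distr (density lborel (indicator (ball z a) :: _ \<Rightarrow> real)) borel (\<lambda>y. norm (y - z)). h s / s)"
    by (subst integral_distr) auto
  also have "\<dots> = (LINT s|density lborel (\<lambda>s. ennreal (indicator {0..a} s * (4 * pi * s\<^sup>2))). h s / s)"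
    unfolding ke using distr_norm_ball[of a z] a by simp
  also have "\<dots> = (LINT s|lborel. (indicator {0..a} s * (4 * pi * s\<^sup>2)) *\<^sub>R (h s / s))"
    by (intro integral_density) (auto split: split_indicator)
  also have "\<dots> = (LINT s|lborel. indicator {0..a} s * (4 * pi * (s * h s)))"
    by (intro Bochner_Integration.integral_cong) (auto simp: power2_eq_square split: split_indicator)
  also have "\<dots> = integral {0..a} (\<lambda>s. 4 * pi * (s * h s))"
    using h by (intro integral_Icc_lborel continuous_intros) (auto intro: continuous_on_subset)
  also have "\<dots> = 4 * pi * G a - 4 * pi * G 0"
    using a by (intro integral_unique has_integral_DERIV DERIV_cmult G) auto
  finally show ?thesis by (simp add: algebra_simps)
qed

text \<open>The radial density s min(r, s) / r is at most \<open>a\<close> on the interval, whatever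
  \<open>r\<close> is. The resulting bound, uniform in \<open>x\<close>, is what makes Fubini
  applicable to the kernel.\<close>

lemma nn_integral_newton_kernel_le:
  fixes x z :: "real^3"
  assumes a: "0 < a" and x: "x \<noteq> z"
  shows "(\<integral>\<^sup>+y. ennreal (1 / (4 * pi * norm (x - y))) \<partial>lebesgue_on (ball z a)) \<le> ennreal (a * a)"
proof -
  have [measurable]: "ball z a \<in> sets borel" by simp
  let ?k = "\<lambda>y. indicator (ball z a) y * ennreal (1 / (4 * pi * norm (x - y)))"
  define r where "r = norm (x - z)"
  have r: "0 < r" using x by (simp add: r_def)
  have "(\<integral>\<^sup>+y. ennreal (1 / (4 * pi * norm (x - y))) \<partial>lebesgue_on (ball z a)) = (\<integral>\<^sup>+y. ?k y \<partial>lebesgue)"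
    by (subst nn_integral_restrict_space) (auto simp: mult_ac)
  also have "\<dots> = (\<integral>\<^sup>+y. ?k y \<partial>lborel)"
    by (rule nn_integral_completion)
  also have "\<dots> = emeasure (distr (density lborel ?k) borel (\<lambda>y. norm (y - z))) UNIV"
    by (subst emeasure_distr) (auto simp: emeasure_density)
  also have "\<dots> = (\<integral>\<^sup>+s. ennreal (indicator {0..a} s * (s * min r s / r)) \<partial>lborel)"
    using a x by (subst distr_norm_newton_kernel) (auto simp: emeasure_density r_def)
  also have "\<dots> \<le> (\<integral>\<^sup>+s. ennreal a * indicator {0..a} s \<partial>lborel)"
  proof (rule nn_integral_mono)
    fix s
    have "s * min r s / r \<le> a" if "0 \<le> s" "s \<le> a"
    proof -
      have "s * min r s \<le> a * r" using that r by (intro mult_mono) auto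
      then show ?thesis using r by (simp add: divide_le_eq)
    qed
    then show "ennreal (indicator {0..a} s * (s * min r s / r)) \<le> ennreal a * indicator {0..a} s"
      by (auto intro: ennreal_leI split: split_indicator)
  qed
  also have "\<dots> = ennreal (a * a)"
    using a by (simp add: nn_integral_cmult ennreal_mult)
  finally show ?thesis .
qed

lemma L2_imp_integrable:
  assumes f: "f \<in> L2 S" and S: "S \<in> lmeasurable"
  shows "integrable (lebesgue_on S) f"
proof (rule Bochner_Integration.integrable_bound)
  have "finite_measure (lebesgue_on S)"
    using S by (rule finite_measure_lebesgue_on)
  then show "integrable (lebesgue_on S) (\<lambda>x. 1 + (f x)\<^sup>2)"
    using f by (auto simp: L2_def intro: finite_measure.integrable_const)
  show "AE x in lebesgue_on S. norm (f x) \<le> norm (1 + (f x)\<^sup>2)"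
  proof (rule AE_I2)
    fix x
    have "0 \<le> (\<bar>f x\<bar> - 1)\<^sup>2 + (f x)\<^sup>2" by simp
    then show "norm (f x) \<le> norm (1 + (f x)\<^sup>2)" by (simp add: power2_diff)
  qed
qed (use f in \<open>auto simp: L2_def\<close>)

text \<open>Fubini for the symmetric kernel. Boundedness of \<open>p\<close> and the uniform kernel
  bound control the integral of the absolute values by B a^2 times the integral of |e|, so
  integrability of \<open>e\<close> suffices.\<close>

lemma newton_symmetric:
  fixes z :: "real^3"
  assumes a: "0 < a" and e: "integrable (lebesgue_on (ball z a)) e"
    and p[measurable]: "p \<in> borel_measurable borel"
    and B: "\<And>x. x \<in> ball z a \<Longrightarrow> \<bar>p x\<bar> \<le> B"
  shows "(LINT x|lebesgue_on (ball z a). p x * newton (ball z a) e x)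
       = (LINT y|lebesgue_on (ball z a). e y * newton (ball z a) p y)"
proof -
  define L where "L = lebesgue_on (ball z a)"
  have "0 \<le> B" using B[of z] a by auto
  interpret finite_measure L
    unfolding L_def by (rule finite_measure_lebesgue_on) simp
  interpret LL: pair_sigma_finite L L ..
  have id[measurable]: "(\<lambda>x. x) \<in> L \<rightarrow>\<^sub>M borel"
    unfolding L_def by (intro measurable_restrict_space1 measurable_completion) simp
  have em[measurable]: "e \<in> borel_measurable L"
    using e by (auto simp: L_def)
  have fstm[measurable]: "fst \<in> L \<Otimes>\<^sub>M L \<rightarrow>\<^sub>M borel" "snd \<in> L \<Otimes>\<^sub>M L \<rightarrow>\<^sub>M borel"
    using measurable_compose[OF measurable_fst id, of L] measurable_compose[OF measurable_snd id, of L] by auto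
  have pm[measurable]: "p \<in> borel_measurable L"
    using measurable_compose[OF id p] by simp
  let ?f = "\<lambda>x y. p x * (e y / (4 * pi * norm (x - y)))"
  have int: "integrable (L \<Otimes>\<^sub>M L) (case_prod ?f)"
  proof (rule integrableI_bounded)
    show fm: "case_prod ?f \<in> borel_measurable (L \<Otimes>\<^sub>M L)"
      unfolding case_prod_beta by measurable
    have "(\<integral>\<^sup>+q. ennreal (norm (case_prod ?f q)) \<partial>(L \<Otimes>\<^sub>M L))
        = (\<integral>\<^sup>+y. \<integral>\<^sup>+x. ennreal (norm (?f x y)) \<partial>L \<partial>L)"
      using LL.nn_integral_snd[of "\<lambda>q. ennreal (norm (case_prod ?f q))"] fm by simp
    also have "\<dots> \<le> (\<integral>\<^sup>+y. ennreal (B * (a * a)) * ennreal (norm (e y)) \<partial>L)"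
    proof (rule nn_integral_mono_AE)
      \<comment> \<open>The kernel bound is stated away from the centre, which is a null
        set.\<close>
      have "AE y in lebesgue. y \<noteq> z"
        by (rule AE_completion) (rule AE_lborel_singleton)
      then have "AE y in L. y \<noteq> z"
        unfolding L_def by (subst AE_restrict_space_iff) auto
      then show "AE y in L. (\<integral>\<^sup>+x. ennreal (norm (?f x y)) \<partial>L) \<le> ennreal (B * (a * a)) * ennreal (norm (e y))"
      proof eventually_elim
        case (elim y)
        have "(\<integral>\<^sup>+x. ennreal (norm (?f x y)) \<partial>L)
            \<le> (\<integral>\<^sup>+x. ennreal (B * norm (e y)) * ennreal (1 / (4 * pi * norm (y - x))) \<partial>L)"
        proof (rule nn_integral_mono)
          fix x assume "x \<in> space L"
          then have "\<bar>p x\<bar> \<le> B" using B by (auto simp: L_def space_restrict_space)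
          then have "\<bar>p x\<bar> * (\<bar>e y\<bar> / (4 * pi * norm (y - x))) \<le> B * (\<bar>e y\<bar> / (4 * pi * norm (y - x)))"
            by (rule mult_right_mono) auto
          then show "ennreal (norm (?f x y)) \<le> ennreal (B * norm (e y)) * ennreal (1 / (4 * pi * norm (y - x)))"
            using \<open>0 \<le> B\<close> by (simp add: ennreal_mult'[symmetric] abs_mult norm_minus_commute)
        qed
        also have "\<dots> = ennreal (B * norm (e y)) * (\<integral>\<^sup>+x. ennreal (1 / (4 * pi * norm (y - x))) \<partial>L)"
          by (rule nn_integral_cmult) measurable
        also have "\<dots> \<le> ennreal (B * norm (e y)) * ennreal (a * a)"
          unfolding L_def using a elim by (intro mult_left_mono nn_integral_newton_kernel_le) auto
        also have "\<dots> = ennreal (B * (a * a)) * ennreal (norm (e y))"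
          using \<open>0 \<le> B\<close> by (simp add: ennreal_mult'[symmetric] mult_ac)
        finally show ?case .
      qed
    qed
    also have "\<dots> = ennreal (B * (a * a)) * (\<integral>\<^sup>+y. ennreal (norm (e y)) \<partial>L)"
      by (rule nn_integral_cmult) measurable
    also have "\<dots> < \<infinity>"
      using e by (auto simp: integrable_iff_bounded L_def ennreal_mult_less_top)
    finally show "(\<integral>\<^sup>+q. ennreal (norm (case_prod ?f q)) \<partial>(L \<Otimes>\<^sub>M L)) < \<infinity>" .
  qed
  have "(LINT x|L. p x * newton (ball z a) e x) = (LINT x|L. LINT y|L. ?f x y)"
    unfolding newton_def L_def[symmetric] by (subst integral_mult_right_zero[symmetric]) (rule refl)
  also have "\<dots> = (LINT y|L. LINT x|L. ?f x y)"
    by (rule LL.Fubini_integral[OF int, symmetric])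
  also have "\<dots> = (LINT y|L. LINT x|L. e y * (p x / (4 * pi * norm (y - x))))"
    by (simp add: norm_minus_commute mult_ac)
  also have "\<dots> = (LINT y|L. e y * newton (ball z a) p y)"
    unfolding newton_def L_def[symmetric] by (subst integral_mult_right_zero) (rule refl)
  finally show ?thesis by (simp add: L_def)
qed

section \<open>Eigenvalues with a non-mean-free eigenfunction\<close>

text \<open>Lets the eigenvalue equation, valid only almost everywhere, be inserted under an
  integral.\<close>

lemma borel_measurable_newton:
  fixes S :: "(real^3) set"
  assumes S: "S \<in> lmeasurable" and f[measurable]: "f \<in> borel_measurable (lebesgue_on S)"
  shows "newton S f \<in> borel_measurable (lebesgue_on S)"
proof -
  interpret finite_measure "lebesgue_on S"
    using S by (rule finite_measure_lebesgue_on)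
  have id: "(\<lambda>x. x) \<in> lebesgue_on S \<rightarrow>\<^sub>M borel"
    by (intro measurable_restrict_space1 measurable_completion) simp
  have [measurable]: "fst \<in> lebesgue_on S \<Otimes>\<^sub>M lebesgue_on S \<rightarrow>\<^sub>M borel" "snd \<in> lebesgue_on S \<Otimes>\<^sub>M lebesgue_on S \<rightarrow>\<^sub>M borel"
    using measurable_compose[OF measurable_fst id, of "lebesgue_on S"]
      measurable_compose[OF measurable_snd id, of "lebesgue_on S"] by auto
  have "(\<lambda>x. LINT y|lebesgue_on S. f y / (4 * pi * norm (x - y))) \<in> borel_measurable (lebesgue_on S)"
    by (rule borel_measurable_lebesgue_integral) (unfold case_prod_beta, measurable)
  then show ?thesis by (simp add: newton_def[abs_def])
qed

lemma DERIV_continuous_on_UNIV: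
  fixes f f' :: "real \<Rightarrow> real"
  assumes "\<And>s. (f has_real_derivative f' s) (at s)"
  shows "continuous_on UNIV f"
  using assms by (meson DERIV_isCont continuous_at_imp_continuous_on)

text \<open>The mean value inequality from 0. It makes the quotient h(s) / s bounded near the
  centre, so that it is an admissible test function.\<close>

lemma DERIV_linear_bound:
  fixes h h' :: "real \<Rightarrow> real"
  assumes "h 0 = 0" "\<And>s. (h has_real_derivative h' s) (at s)" "continuous_on UNIV h'"
  obtains B where "\<And>s. s \<in> {0..a} \<Longrightarrow> \<bar>h s\<bar> \<le> B * s"
proof -
  have "bounded (h' ` {0..a})"
    using assms(3) by (intro compact_imp_bounded compact_continuous_image) (auto intro: continuous_on_subset)
  then obtain B where "\<forall>t\<in>h' ` {0..a}. norm t \<le> B"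
    unfolding bounded_iff by blast
  then have B: "norm (h' s) \<le> B" if "s \<in> {0..a}" for s
    using that by blast
  have "\<bar>h s\<bar> \<le> B * s" if "s \<in> {0..a}" for s
  proof -
    have "norm (h s - h 0) \<le> B * norm (s - 0)"
      by (rule field_differentiable_bound[of "{0..a}" h h'])
        (use that assms(2) B in \<open>auto intro: has_field_derivative_at_within\<close>)
    then show ?thesis using that assms(1) by simp
  qed
  then show ?thesis by (rule that)
qed

lemma integrable_times_radial:
  fixes z :: "real^3" and g :: "real \<Rightarrow> real"
  assumes e: "integrable (lebesgue_on (ball z a)) e" and g: "g \<in> borel_measurable borel"
    and B: "\<And>s. s \<in> {0..a} \<Longrightarrow> \<bar>g s\<bar> \<le> B"
  shows "integrable (lebesgue_on (ball z a)) (\<lambda>y. e y * g (norm (y - z)))"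
proof (rule Bochner_Integration.integrable_bound)
  show "integrable (lebesgue_on (ball z a)) (\<lambda>y. B * e y)"
    using e by simp
  have "(\<lambda>x. x) \<in> lebesgue_on (ball z a) \<rightarrow>\<^sub>M borel"
    by (intro measurable_restrict_space1 measurable_completion) simp
  with e g show "(\<lambda>y. e y * g (norm (y - z))) \<in> borel_measurable (lebesgue_on (ball z a))"
    by measurable
  show "AE y in lebesgue_on (ball z a). norm (e y * g (norm (y - z))) \<le> norm (B * e y)"
  proof (rule AE_I2)
    fix y assume "y \<in> space (lebesgue_on (ball z a))"
    then have "norm (y - z) \<in> {0..a}"
      by (auto simp: space_restrict_space dist_norm norm_minus_commute)
    from B[OF this] show "norm (e y * g (norm (y - z))) \<le> norm (B * e y)"
      using mult_right_mono[of "\<bar>g (norm (y - z))\<bar>" "\<bar>B\<bar>" "\<bar>e y\<bar>"] by (simp add: abs_mult mult.commute)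
  qed
qed

lemma AE_lebesgue_on_neq:
  fixes z :: "'a::euclidean_space"
  assumes "S \<in> sets lebesgue"
  shows "AE y in lebesgue_on S. y \<noteq> z"
proof -
  have "AE y in lebesgue. y \<noteq> z"
    by (rule AE_completion) (rule AE_lborel_singleton)
  then show ?thesis
    using assms by (subst AE_restrict_space_iff) auto
qed

text \<open>The eigenvalue equation integrated against h(s) / s. Symmetry transfers the operator to
  this test function, where \<open>newton_radial\<close> evaluates it; nothing about
  \<open>e\<close> beyond integrability and the equation enters.\<close>

lemma newton_eigenfunction_radial:
  fixes z :: "real^3" and h h' G\<^sub>1 G\<^sub>2 :: "real \<Rightarrow> real"
  assumes a: "0 < a" and e: "integrable (lebesgue_on (ball z a)) e"
    and eig: "AE x in lebesgue_on (ball z a). newton (ball z a) e x = \<mu> * e x"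
    and h0: "h 0 = 0" and h: "\<And>s. (h has_real_derivative h' s) (at s)" and h': "continuous_on UNIV h'"
    and G1: "\<And>s. (G\<^sub>1 has_real_derivative s * h s) (at s)"
    and G2: "\<And>s. (G\<^sub>2 has_real_derivative h s) (at s)"
  shows "\<mu> * (LINT y|lebesgue_on (ball z a). e y * (h (norm (y - z)) / norm (y - z)))
     = (LINT y|lebesgue_on (ball z a). e y * ((G\<^sub>1 (norm (y - z)) - G\<^sub>1 0) / norm (y - z) + G\<^sub>2 a - G\<^sub>2 (norm (y - z))))"
proof -
  define L where "L = lebesgue_on (ball z a)"
  define p where "p = (\<lambda>y. h (norm (y - z)) / norm (y - z))"
  define q where "q = (\<lambda>y. (G\<^sub>1 (norm (y - z)) - G\<^sub>1 0) / norm (y - z) + G\<^sub>2 a - G\<^sub>2 (norm (y - z)))"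
  have [measurable]: "h \<in> borel_measurable borel" "G\<^sub>1 \<in> borel_measurable borel" "G\<^sub>2 \<in> borel_measurable borel"
    using DERIV_continuous_on_UNIV[OF h] DERIV_continuous_on_UNIV[OF G1] DERIV_continuous_on_UNIV[OF G2] by (auto intro: borel_measurable_continuous_onI)
  have id: "(\<lambda>x. x) \<in> L \<rightarrow>\<^sub>M borel"
    unfolding L_def by (intro measurable_restrict_space1 measurable_completion) simp
  have pm: "p \<in> borel_measurable borel" and qm: "q \<in> borel_measurable borel"
    unfolding p_def q_def by measurable
  have [measurable]: "p \<in> borel_measurable L" "q \<in> borel_measurable L" "e \<in> borel_measurable L"
    using measurable_compose[OF id pm] measurable_compose[OF id qm] e by (auto simp: L_def)
  have [measurable]: "newton (ball z a) e \<in> borel_measurable L" "newton (ball z a) p \<in> borel_measurable L"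
    unfolding L_def by (intro borel_measurable_newton; simp flip: L_def)+
  obtain B where B: "\<And>s. s \<in> {0..a} \<Longrightarrow> \<bar>h s\<bar> \<le> B * s"
    using DERIV_linear_bound[OF h0 h h'] by blast
  have "0 \<le> B"
    using B[of a] a by (auto simp: zero_le_mult_iff dest: order_trans[OF abs_ge_zero])
  \<comment> \<open>At the centre division by zero gives p z = 0, so the bound holds there as
    well.\<close>
  have pB: "\<bar>p x\<bar> \<le> B" if "x \<in> ball z a" for x
  proof -
    have "norm (x - z) \<in> {0..a}" using that by (auto simp: dist_norm norm_minus_commute)
    from B[OF this] \<open>0 \<le> B\<close> show ?thesis
      by (cases "x = z") (auto simp: p_def divide_le_eq)
  qed
  have "\<mu> * (LINT y|L. e y * p y) = (LINT y|L. p y * (\<mu> * e y))"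
    by (simp add: mult_ac flip: integral_mult_right_zero)
  also have "\<dots> = (LINT y|L. p y * newton (ball z a) e y)"
    using eig unfolding L_def[symmetric] by (intro integral_cong_AE) auto
  also have "\<dots> = (LINT y|L. e y * newton (ball z a) p y)"
    unfolding L_def by (rule newton_symmetric[OF a e pm pB])
  also have "\<dots> = (LINT y|L. e y * q y)"
  proof (rule integral_cong_AE)
    have "AE y in L. y \<noteq> z"
      unfolding L_def by (rule AE_lebesgue_on_neq) auto
    then show "AE y in L. e y * newton (ball z a) p y = e y * q y"
      using AE_space
    proof eventually_elim
      case (elim y)
      then have "y \<in> ball z a" by (auto simp: L_def space_restrict_space)
      then have "newton (ball z a) p y = q y"
        unfolding p_def q_def using elim(1) by (intro newton_radial DERIV_continuous_on_UNIV[OF h] G1 G2)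
      then show ?case by simp
    qed
  qed auto
  finally show ?thesis by (simp add: L_def p_def q_def)
qed

text \<open>Each radial test function \<open>sin (k s) / s\<close>, \<open>sinh (k s) / s\<close> is mapped by the Newtonian
  operator to a multiple of itself plus a constant; with \<open>k\<close> tuned to \<open>\<mu>\<close> the multiple is \<open>\<mu>\<close>, so that
  symmetry forces the constant times the mean of \<open>e\<close> to vanish. For \<open>\<mu> = 0\<close> powers of \<open>s\<close> of growing
  degree take over this role.\<close>

lemma newton_eig_mean_pos:
  fixes z :: "real^3"
  assumes a: "0 < a" and eig: "newton_eig_mean (ball z a) \<mu>"
  shows "0 < \<mu> \<and> cos (a / sqrt \<mu>) = 0"
proof -
  obtain e where e2: "e \<in> L2 (ball z a)"
    and ee: "AE x in lebesgue_on (ball z a). newton (ball z a) e x = \<mu> * e x"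
    and mean: "(LINT y|lebesgue_on (ball z a). e y) \<noteq> 0"
    using eig by (auto simp: newton_eig_mean_def)
  have e: "integrable (lebesgue_on (ball z a)) e"
    using e2 by (rule L2_imp_integrable) simp
  note radial = newton_eigenfunction_radial[OF a e ee]
  define m where "m = (LINT y|lebesgue_on (ball z a). e y)"
  have resonance: "d = 0"
    if h0: "h 0 = 0" and h: "\<And>s. (h has_real_derivative h' s) (at s)" and h': "continuous_on UNIV h'"
      and G1: "\<And>s. (G\<^sub>1 has_real_derivative s * h s) (at s)"
      and G2: "\<And>s. (G\<^sub>2 has_real_derivative h s) (at s)"
      and q: "\<And>s. s > 0 \<Longrightarrow> (G\<^sub>1 s - G\<^sub>1 0) / s + G\<^sub>2 a - G\<^sub>2 s = \<mu> * (h s / s) + d"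
    for h h' G\<^sub>1 G\<^sub>2 :: "real \<Rightarrow> real" and d
  proof -
    obtain B where B: "\<And>s. s \<in> {0..a} \<Longrightarrow> \<bar>h s\<bar> \<le> B * s"
      using DERIV_linear_bound[OF h0 h h'] by blast
    have "0 \<le> B"
      using B[of a] a by (auto simp: zero_le_mult_iff dest: order_trans[OF abs_ge_zero])
    have "(\<lambda>s. h s / s) \<in> borel_measurable borel"
      using DERIV_continuous_on_UNIV[OF h] by (intro borel_measurable_divide borel_measurable_continuous_onI) auto
    moreover have "\<bar>h s / s\<bar> \<le> B" if "s \<in> {0..a}" for s
      using B[OF that] that \<open>0 \<le> B\<close> by (cases "s = 0") (auto simp: divide_le_eq)
    ultimately have int: "integrable (lebesgue_on (ball z a)) (\<lambda>y. e y * (h (norm (y - z)) / norm (y - z)))"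
      by (intro integrable_times_radial[OF e, where g = "\<lambda>s. h s / s"])
    have "AE y in lebesgue_on (ball z a). y \<noteq> z"
      by (rule AE_lebesgue_on_neq) auto
    have "\<mu> * (LINT y|lebesgue_on (ball z a). e y * (h (norm (y - z)) / norm (y - z)))
      = (LINT y|lebesgue_on (ball z a). e y * ((G\<^sub>1 (norm (y - z)) - G\<^sub>1 0) / norm (y - z) + G\<^sub>2 a - G\<^sub>2 (norm (y - z))))"
      by (rule radial[OF h0 h h' G1 G2])
    also have "\<dots> = (LINT y|lebesgue_on (ball z a). \<mu> * (e y * (h (norm (y - z)) / norm (y - z))) + d * e y)"
    proof (rule integral_cong_AE)
      have "(\<lambda>s. (G\<^sub>1 s - G\<^sub>1 0) / s + G\<^sub>2 a - G\<^sub>2 s) \<in> borel_measurable borel"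
        using DERIV_continuous_on_UNIV[OF G1] DERIV_continuous_on_UNIV[OF G2] 
        by (intro borel_measurable_add borel_measurable_diff borel_measurable_divide borel_measurable_continuous_onI) auto
      moreover have "(\<lambda>y. norm (y - z)) \<in> lebesgue_on (ball z a) \<rightarrow>\<^sub>M borel"
        by (intro measurable_restrict_space1 measurable_completion) simp
      ultimately have "(\<lambda>y. (G\<^sub>1 (norm (y - z)) - G\<^sub>1 0) / norm (y - z) + G\<^sub>2 a - G\<^sub>2 (norm (y - z))) \<in> borel_measurable (lebesgue_on (ball z a))"
        by (rule measurable_compose[rotated])
      then show "(\<lambda>y. e y * ((G\<^sub>1 (norm (y - z)) - G\<^sub>1 0) / norm (y - z) + G\<^sub>2 a - G\<^sub>2 (norm (y - z)))) \<in> borel_measurable (lebesgue_on (ball z a))"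
        using e by (intro borel_measurable_times) auto
      show "(\<lambda>y. \<mu> * (e y * (h (norm (y - z)) / norm (y - z))) + d * e y) \<in> borel_measurable (lebesgue_on (ball z a))"
        using e int by (intro borel_measurable_add borel_measurable_times[OF borel_measurable_const]) auto
      show "AE y in lebesgue_on (ball z a). e y * ((G\<^sub>1 (norm (y - z)) - G\<^sub>1 0) / norm (y - z) + G\<^sub>2 a - G\<^sub>2 (norm (y - z)))
          = \<mu> * (e y * (h (norm (y - z)) / norm (y - z))) + d * e y"
        using \<open>AE y in lebesgue_on (ball z a). y \<noteq> z\<close>
      proof eventually_elim
        case (elim y)
        show ?case
          using q[of "norm (y - z)"] elim by (simp only: zero_less_norm_iff) (simp add: algebra_simps)
      qed
    qed
    also have "\<dots> = \<mu> * (LINT y|lebesgue_on (ball z a). e y * (h (norm (y - z)) / norm (y - z))) + d * m"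
      using e int by (simp only: Bochner_Integration.integral_add integrable_mult_right integral_mult_right_zero m_def)
    finally show "d = 0" using mean by (simp add: m_def)
  qed
  consider "\<mu> > 0" | "\<mu> < 0" | "\<mu> = 0" by linarith
  then show ?thesis
  proof cases
    case 1
    define k where "k = 1 / sqrt \<mu>"
    have k: "k > 0" "\<mu> = 1 / k\<^sup>2" using 1 by (auto simp: k_def power_divide)
    \<comment> \<open>The constant left over is the value of \<open>G\<^sub>2\<close> at
      \<open>a\<close>; the cosine terms at radius s cancel between the inner and the outer
      shells.\<close>
    have "- cos (k * a) / k = 0"
    proof (rule resonance[where h = "\<lambda>s. sin (k * s)" and h' = "\<lambda>s. k * cos (k * s)"
          and G\<^sub>1 = "\<lambda>s. sin (k * s) / k\<^sup>2 - s * cos (k * s) / k" and G\<^sub>2 = "\<lambda>s. - cos (k * s) / k"])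
      show "((\<lambda>s. sin (k * s) / k\<^sup>2 - s * cos (k * s) / k) has_real_derivative s * sin (k * s)) (at s)" for s
        using k by (auto intro!: derivative_eq_intros simp: field_simps power2_eq_square)
      show "((\<lambda>s. sin (k * s)) has_real_derivative k * cos (k * s)) (at s)" for s
        by (auto intro!: derivative_eq_intros)
      show "((\<lambda>s. - cos (k * s) / k) has_real_derivative sin (k * s)) (at s)" for s
        using k(1) by (auto intro!: derivative_eq_intros)
      show "(sin (k * s) / k\<^sup>2 - s * cos (k * s) / k - (sin (k * 0) / k\<^sup>2 - 0 * cos (k * 0) / k)) / s + - cos (k * a) / k - - cos (k * s) / k
          = \<mu> * (sin (k * s) / s) + - cos (k * a) / k" if "s > 0" for s
        using k(1) that by (simp add: k(2) field_simps power2_eq_square)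
    qed (auto intro!: continuous_intros)
    then have "cos (k * a) = 0" using k(1) by simp
    then show ?thesis using 1 by (simp add: k_def)
  next
    case 2
    define k where "k = 1 / sqrt (-\<mu>)"
    have k: "k > 0" "\<mu> = - 1 / k\<^sup>2" using 2 by (auto simp: k_def power_divide)
    \<comment> \<open>The hyperbolic analogue leaves cosh(k a) / k as its constant. It is never
      zero, so a negative eigenvalue is contradictory.\<close>
    have "cosh (k * a) / k = 0"
    proof (rule resonance[where h = "\<lambda>s. sinh (k * s)" and h' = "\<lambda>s. k * cosh (k * s)"
          and G\<^sub>1 = "\<lambda>s. s * cosh (k * s) / k - sinh (k * s) / k\<^sup>2" and G\<^sub>2 = "\<lambda>s. cosh (k * s) / k"])
      show "((\<lambda>s. s * cosh (k * s) / k - sinh (k * s) / k\<^sup>2) has_real_derivative s * sinh (k * s)) (at s)" for s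
        using k by (auto intro!: derivative_eq_intros simp: field_simps power2_eq_square)
      show "((\<lambda>s. sinh (k * s)) has_real_derivative k * cosh (k * s)) (at s)" for s
        by (auto intro!: derivative_eq_intros)
      show "((\<lambda>s. cosh (k * s) / k) has_real_derivative sinh (k * s)) (at s)" for s
        using k(1) by (auto intro!: derivative_eq_intros)
      show "(s * cosh (k * s) / k - sinh (k * s) / k\<^sup>2 - (0 * cosh (k * 0) / k - sinh (k * 0) / k\<^sup>2)) / s + cosh (k * a) / k - cosh (k * s) / k
          = \<mu> * (sinh (k * s) / s) + cosh (k * a) / k" if "s > 0" for s
        using k(1) that by (simp add: k(2) field_simps power2_eq_square)
    qed (auto intro!: continuous_intros)
    then show ?thesis using k(1) by simp
  next
    case 3
    define M where "M = (LINT y|lebesgue_on (ball z a). \<bar>e y\<bar>)"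
    \<comment> \<open>The potential of the density s^n is (a^N - s^N / (n + 3)) / (n + 2) with N = n
      + 2. For eigenvalue 0 it integrates to zero against \<open>e\<close>, so a^N (n + 3) m equals
      the integral of e s^N, which is at most a^N M in absolute value. As n is arbitrary, a nonzero
      mean is impossible.\<close>
    have "real (n + 3) * \<bar>m\<bar> \<le> M" for n
    proof -
      let ?r = "\<lambda>y. norm (y - z)"
      let ?G1 = "\<lambda>s::real. s ^ (n + 3) / real (n + 3)" and ?G2 = "\<lambda>s::real. s ^ (n + 2) / real (n + 2)"
      define N where "N = n + 2"
      define I where "I = (LINT y|lebesgue_on (ball z a). e y * ?r y ^ N)"
      have int: "integrable (lebesgue_on (ball z a)) (\<lambda>y. e y * ?r y ^ N)"
        by (rule integrable_times_radial[OF e, where g = "\<lambda>s. s ^ N" and B = "a ^ N"])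
          (auto intro: power_mono simp: power_abs)
      have "0 = (LINT y|lebesgue_on (ball z a). e y * ((?G1 (?r y) - ?G1 0) / ?r y + ?G2 a - ?G2 (?r y)))"
      proof (rule trans[OF _ radial[of "\<lambda>s. s ^ Suc n" "\<lambda>s. real (Suc n) * s ^ n"]])
        show "((\<lambda>s. s ^ Suc n) has_real_derivative real (Suc n) * s ^ n) (at s)" for s
          by (rule DERIV_cong[OF DERIV_pow]) simp
        have "(?G1 has_real_derivative real (n + 3) * s ^ (n + 3 - Suc 0) / real (n + 3)) (at s)" for s
          by (rule DERIV_cdivide[OF DERIV_pow])
        then show "(?G1 has_real_derivative s * s ^ Suc n) (at s)" for s
          by (simp add: numeral_3_eq_3)
        have "(?G2 has_real_derivative real (n + 2) * s ^ (n + 2 - Suc 0) / real (n + 2)) (at s)" for s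
          by (rule DERIV_cdivide[OF DERIV_pow])
        then show "(?G2 has_real_derivative s ^ Suc n) (at s)" for s
          by (simp add: numeral_2_eq_2)
      qed (auto intro!: continuous_intros simp: 3)
      also have "\<dots> = (LINT y|lebesgue_on (ball z a). a ^ N / real (n + 2) * e y - 1 / (real (n + 2) * real (n + 3)) * (e y * ?r y ^ N))"
      proof (rule Bochner_Integration.integral_cong[OF refl])
        fix y
        have "(?G1 s - ?G1 0) / s + ?G2 a - ?G2 s = a ^ N / real (n + 2) - s ^ N / (real (n + 2) * real (n + 3))" for s :: real
        proof -
          have "(?G1 s - ?G1 0) / s = s ^ N / real (n + 3)"
            by (cases "s = 0") (auto simp: N_def power_add power3_eq_cube power2_eq_square)
          moreover have "s ^ N / real (n + 3) - s ^ N / real (n + 2) = - (s ^ N / (real (n + 2) * real (n + 3)))"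
            by (simp add: field_simps)
          ultimately show ?thesis by (simp add: N_def)
        qed
        from this[of "?r y"] show "e y * ((?G1 (?r y) - ?G1 0) / ?r y + ?G2 a - ?G2 (?r y))
            = a ^ N / real (n + 2) * e y - 1 / (real (n + 2) * real (n + 3)) * (e y * ?r y ^ N)"
          by (simp only:) (simp add: right_diff_distrib mult_ac)
      qed
      also have "\<dots> = a ^ N / real (n + 2) * m - 1 / (real (n + 2) * real (n + 3)) * I"
        using e int by (simp only: Bochner_Integration.integral_diff integrable_mult_right integral_mult_right_zero m_def I_def)
      finally have "0 = a ^ N / real (n + 2) * m - 1 / (real (n + 2) * real (n + 3)) * I" .
      moreover have "A * (c' * m) = I" if "0 = A / c * m - 1 / (c * c') * I" "c > 0" "c' > 0" for A c c' :: real
        using that by (simp add: field_simps)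
      ultimately have "a ^ N * (real (n + 3) * m) = I"
        by simp
      then have "a ^ N * (real (n + 3) * \<bar>m\<bar>) = \<bar>I\<bar>"
        using a by (auto simp: abs_mult)
      also have "\<bar>I\<bar> \<le> (LINT y|lebesgue_on (ball z a). \<bar>e y * ?r y ^ N\<bar>)"
        unfolding I_def by (rule integral_abs_bound)
      also have "\<dots> \<le> (LINT y|lebesgue_on (ball z a). a ^ N * \<bar>e y\<bar>)"
      proof (rule integral_mono)
        fix y assume "y \<in> space (lebesgue_on (ball z a))"
        then have "?r y ^ N \<le> a ^ N"
          by (intro power_mono) (auto simp: space_restrict_space dist_norm norm_minus_commute)
        then show "\<bar>e y * ?r y ^ N\<bar> \<le> a ^ N * \<bar>e y\<bar>"
          by (simp add: abs_mult mult.commute mult_left_mono)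
      qed (use e int in auto)
      also have "\<dots> = a ^ N * M" by (simp add: M_def)
      finally show ?thesis using a by simp
    qed
    then have "real (n + 3) \<le> M / \<bar>m\<bar>" for n
      using mean by (simp add: m_def le_divide_eq)
    then show ?thesis
      using real_arch_simple[of "M / \<bar>m\<bar>"] by (metis of_nat_add le_add1 of_nat_le_iff order_trans not_less_eq_eq numeral_3_eq_3 add_Suc_right)
  qed
qed

text \<open>For sin(k s) / s the leftover constant - cos(k a) / k is zero by assumption, so this
  function is an eigenfunction. Its mean is 4 pi sin(k a) / k^2, and sine and cosine have no common
  zero.\<close>

lemma newton_eig_meanI:
  fixes z :: "real^3"
  assumes a: "0 < a" and k: "0 < k" and cos0: "cos (k * a) = 0"
  shows "newton_eig_mean (ball z a) (1 / k\<^sup>2)"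
proof -
  define h where "h = (\<lambda>s. sin (k * s))"
  define G\<^sub>1 where "G\<^sub>1 = (\<lambda>s. sin (k * s) / k\<^sup>2 - s * cos (k * s) / k)"
  define G\<^sub>2 where "G\<^sub>2 = (\<lambda>s. - cos (k * s) / k)"
  define p where "p = (\<lambda>y. h (norm (y - z)) / norm (y - z))"
  have h: "(h has_real_derivative k * cos (k * s)) (at s)"
    and G1: "(G\<^sub>1 has_real_derivative s * h s) (at s)"
    and G2: "(G\<^sub>2 has_real_derivative h s) (at s)" for s
    using k unfolding h_def G\<^sub>1_def G\<^sub>2_def
    by (auto intro!: derivative_eq_intros simp: field_simps power2_eq_square)
  have hc: "continuous_on UNIV h"
    unfolding h_def by (intro continuous_intros)
  have bound: "\<bar>h s / s\<bar> \<le> k" for s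
    using abs_sin_x_le_abs_x[of "k * s"] k by (cases "s = 0") (auto simp: h_def divide_le_eq abs_mult)
  have hm: "(\<lambda>s. h s / s) \<in> borel_measurable borel"
    using hc by (intro borel_measurable_divide borel_measurable_continuous_onI) auto
  have ball_lebesgue: "ball z a \<in> sets lebesgue" by simp
  have one: "integrable (lebesgue_on (ball z a)) (\<lambda>y. 1 :: real)"
    by (intro finite_measure.integrable_const finite_measure_lebesgue_on) simp
  have "integrable (lebesgue_on (ball z a)) (\<lambda>y. 1 * (h (norm (y - z)) / norm (y - z)))"
    by (rule integrable_times_radial[OF one hm]) (rule bound)
  then have "p \<in> borel_measurable (lebesgue_on (ball z a))"
    by (auto simp: p_def)
  moreover have "integrable (lebesgue_on (ball z a)) (\<lambda>y. 1 * (h (norm (y - z)) / norm (y - z))\<^sup>2)"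
    by (rule integrable_times_radial[OF one, where g = "\<lambda>s. (h s / s)\<^sup>2" and B = "k\<^sup>2"])
      (use hm bound k abs_le_square_iff[of "h s / s" k for s] in auto)
  ultimately have "p \<in> L2 (ball z a)"
    by (simp add: L2_def p_def)
  moreover have "AE x in lebesgue_on (ball z a). newton (ball z a) p x = 1 / k\<^sup>2 * p x"
    using AE_lebesgue_on_neq[OF ball_lebesgue, of z] AE_space
  proof eventually_elim
    case (elim x)
    then have "x \<in> ball z a" by (auto simp: space_restrict_space)
    then have "newton (ball z a) p x = (G\<^sub>1 (norm (x - z)) - G\<^sub>1 0) / norm (x - z) + G\<^sub>2 a - G\<^sub>2 (norm (x - z))"
      unfolding p_def using elim(1) by (intro newton_radial hc G1 G2)
    also have "\<dots> = 1 / k\<^sup>2 * p x"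
      using elim(1) k cos0 by (simp add: G\<^sub>1_def G\<^sub>2_def p_def h_def field_simps)
    finally show ?case .
  qed
  moreover have "(LINT y|lebesgue_on (ball z a). p y) \<noteq> 0"
  proof -
    have "sin (k * a) \<noteq> 0"
      using cos0 sin_cos_squared_add[of "k * a"] by auto
    then show ?thesis
      unfolding p_def integral_ball_radial[OF a hc G1] using k cos0 by (simp add: G\<^sub>1_def)
  qed
  ultimately show ?thesis
    unfolding newton_eig_mean_def by blast
qed

lemma newton_eig_mean_iff:
  fixes z :: "real^3"
  assumes a: "0 < a"
  shows "newton_eig_mean (ball z a) \<mu> \<longleftrightarrow> (\<exists>n::nat. \<mu> = (a / ((real n + 1/2) * pi))\<^sup>2)"
proof
  assume "newton_eig_mean (ball z a) \<mu>"
  from newton_eig_mean_pos[OF a this] have \<mu>: "0 < \<mu>" "cos (a / sqrt \<mu>) = 0" by auto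
  \<comment> \<open>The argument is positive, so only positive odd multiples of pi / 2 occur, and
    the index n below starts at 0.\<close>
  then obtain m where "odd m" and m: "a / sqrt \<mu> = real m * (pi / 2)"
    using cos_zero_lemma[of "a / sqrt \<mu>"] a by auto
  then obtain n where "m = 2 * n + 1" by (auto elim: oddE)
  with m have "a = sqrt \<mu> * ((real n + 1/2) * pi)"
    using \<mu> by (simp add: divide_eq_eq algebra_simps)
  then have "sqrt \<mu> = a / ((real n + 1/2) * pi)"
    by (simp add: eq_divide_eq add_pos_nonneg)
  then show "\<exists>n::nat. \<mu> = (a / ((real n + 1/2) * pi))\<^sup>2"
    using \<mu> by (metis less_imp_le real_sqrt_pow2)
next
  assume "\<exists>n::nat. \<mu> = (a / ((real n + 1/2) * pi))\<^sup>2"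
  then obtain n :: nat where \<mu>: "\<mu> = (a / ((real n + 1/2) * pi))\<^sup>2" ..
  define k where "k = (real n + 1/2) * pi / a"
  have "cos (k * a) = cos (real n * pi + pi / 2)"
    using a by (intro arg_cong[where f = cos]) (simp add: k_def field_simps)
  also have "\<dots> = 0" by (simp add: cos_add)
  finally have "newton_eig_mean (ball z a) (1 / k\<^sup>2)"
    using a by (intro newton_eig_meanI) (auto simp: k_def)
  then show "newton_eig_mean (ball z a) \<mu>"
    by (simp add: \<mu> k_def power_divide)
qed

section \<open>The half-integer trigonometric system\<close>

lemma L2_add:
  assumes "f \<in> L2 S" "g \<in> L2 S"
  shows "(\<lambda>x. f x + g x) \<in> L2 S"
proof -
  have [measurable]: "f \<in> borel_measurable (lebesgue_on S)" "g \<in> borel_measurable (lebesgue_on S)"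
    using assms by (auto simp: L2_def)
  have "integrable (lebesgue_on S) (\<lambda>x. (f x + g x)\<^sup>2)"
  proof (rule Bochner_Integration.integrable_bound)
    show "integrable (lebesgue_on S) (\<lambda>x. 2 * (f x)\<^sup>2 + 2 * (g x)\<^sup>2)"
      using assms by (auto simp: L2_def)
    have "(f x + g x)\<^sup>2 \<le> 2 * (f x)\<^sup>2 + 2 * (g x)\<^sup>2" for x
      using sum_squares_bound[of "f x" "g x"] by (simp add: power2_sum)
    then show "AE x in lebesgue_on S. norm ((f x + g x)\<^sup>2) \<le> norm (2 * (f x)\<^sup>2 + 2 * (g x)\<^sup>2)"
      by simp
  qed measurable
  then show ?thesis using assms by (auto simp: L2_def)
qed

lemma L2_cmult: "f \<in> L2 S \<Longrightarrow> (\<lambda>x. c * f x) \<in> L2 S"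
  by (auto simp: L2_def power_mult_distrib)

lemma L2_diff: "f \<in> L2 S \<Longrightarrow> g \<in> L2 S \<Longrightarrow> (\<lambda>x. f x - g x) \<in> L2 S"
  using L2_add[of f S "\<lambda>x. -1 * g x"] L2_cmult[of g S "-1"] by simp

lemma L2_sum: "finite F \<Longrightarrow> (\<And>i. i \<in> F \<Longrightarrow> f i \<in> L2 S) \<Longrightarrow> (\<lambda>x. \<Sum>i\<in>F. f i x) \<in> L2 S"
proof (induction F rule: finite_induct)
  case empty
  then show ?case by (simp add: L2_def)
next
  case (insert i F)
  then show ?case by (simp add: L2_add)
qed

lemma L2norm2_add_le:
  assumes "f \<in> L2 S" "g \<in> L2 S"
  shows "L2norm2 S (\<lambda>x. f x + g x) \<le> 2 * L2norm2 S f + 2 * L2norm2 S g"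
proof -
  have "L2norm2 S (\<lambda>x. f x + g x) \<le> (LINT x|lebesgue_on S. 2 * (f x)\<^sup>2 + 2 * (g x)\<^sup>2)"
    unfolding L2norm2_def
  proof (rule integral_mono)
    show "integrable (lebesgue_on S) (\<lambda>x. (f x + g x)\<^sup>2)"
      using L2_add[OF assms] by (simp add: L2_def)
    show "integrable (lebesgue_on S) (\<lambda>x. 2 * (f x)\<^sup>2 + 2 * (g x)\<^sup>2)"
      using assms by (auto simp: L2_def)
    show "(f x + g x)\<^sup>2 \<le> 2 * (f x)\<^sup>2 + 2 * (g x)\<^sup>2" for x
      using sum_squares_bound[of "f x" "g x"] by (auto simp: power2_sum)
  qed
  also have "\<dots> = 2 * L2norm2 S f + 2 * L2norm2 S g"
    using assms by (simp add: L2norm2_def L2_def)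
  finally show ?thesis .
qed

lemma L2norm2_cong: "(\<And>x. x \<in> S \<Longrightarrow> f x = g x) \<Longrightarrow> L2norm2 S f = L2norm2 S g"
  unfolding L2norm2_def by (intro Bochner_Integration.integral_cong) (auto simp: space_restrict_space)

lemma L2_cong: "(\<And>x. x \<in> S \<Longrightarrow> f x = g x) \<Longrightarrow> f \<in> L2 S \<longleftrightarrow> g \<in> L2 S"
proof -
  assume *: "\<And>x. x \<in> S \<Longrightarrow> f x = g x"
  then have "f \<in> borel_measurable (lebesgue_on S) \<longleftrightarrow> g \<in> borel_measurable (lebesgue_on S)"
    by (intro measurable_cong) (auto simp: space_restrict_space)
  moreover have "integrable (lebesgue_on S) (\<lambda>x. (f x)\<^sup>2) \<longleftrightarrow> integrable (lebesgue_on S) (\<lambda>x. (g x)\<^sup>2)"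
    using * by (intro Bochner_Integration.integrable_cong) (auto simp: space_restrict_space)
  ultimately show ?thesis by (simp add: L2_def)
qed

lemma L2_bound:
  assumes w: "w \<in> L2 S" and f: "f \<in> borel_measurable (lebesgue_on S)"
    and le: "AE x in lebesgue_on S. \<bar>f x\<bar> \<le> w x"
  shows "f \<in> L2 S"
proof -
  have "integrable (lebesgue_on S) (\<lambda>x. (f x)\<^sup>2)"
  proof (rule Bochner_Integration.integrable_bound)
    show "integrable (lebesgue_on S) (\<lambda>x. (w x)\<^sup>2)" using w by (simp add: L2_def)
    show "(\<lambda>x. (f x)\<^sup>2) \<in> borel_measurable (lebesgue_on S)" using f by measurable
    show "AE x in lebesgue_on S. norm ((f x)\<^sup>2) \<le> norm ((w x)\<^sup>2)"
      using le by eventually_elim (auto simp: abs_le_square_iff[symmetric])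
  qed
  then show ?thesis using f by (simp add: L2_def)
qed

lemma L2_continuous_on:
  fixes f :: "real \<Rightarrow> real"
  assumes "continuous_on {a..b} f"
  shows "f \<in> L2 {a..b}"
  using assms by (auto simp: L2_def intro!: continuous_imp_integrable_real continuous_intros
      continuous_imp_measurable_on_sets_lebesgue)

section \<open>The closed span of a family in \<open>L2\<close>\<close>

definition L2_approximable :: "'a::euclidean_space set \<Rightarrow> ('i \<Rightarrow> 'a \<Rightarrow> real) \<Rightarrow> ('a \<Rightarrow> real) \<Rightarrow> bool" where
  "L2_approximable S p g \<longleftrightarrow> g \<in> L2 S \<and>
     (\<forall>\<epsilon>>0. \<exists>F c. finite F \<and> L2norm2 S (\<lambda>x. g x - (\<Sum>i\<in>F. c i * p i x)) < \<epsilon>)"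

lemma L2_approximable_cong:
  assumes "\<And>x. x \<in> S \<Longrightarrow> f x = g x"
  shows "L2_approximable S p f \<longleftrightarrow> L2_approximable S p g"
proof -
  have "L2norm2 S (\<lambda>x. f x - q x) = L2norm2 S (\<lambda>x. g x - q x)" for q
    using assms by (intro L2norm2_cong) auto
  then show ?thesis
    using L2_cong[of S f g, OF assms] by (simp add: L2_approximable_def)
qed

lemma L2_approximable_basis:
  assumes "p i \<in> L2 S"
  shows "L2_approximable S p (p i)"
proof -
  have zero: "L2norm2 S (\<lambda>x. p i x - (\<Sum>j\<in>{i}. 1 * p j x)) = 0"
    by (simp add: L2norm2_def)
  show ?thesis
    unfolding L2_approximable_def
  proof (intro conjI allI impI assms)
    fix \<epsilon> :: real assume "\<epsilon> > 0"
    with zero show "\<exists>F c. finite F \<and> L2norm2 S (\<lambda>x. p i x - (\<Sum>j\<in>F. c j * p j x)) < \<epsilon>"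
      by (intro exI[of _ "{i}"] exI[of _ "\<lambda>_. 1"]) (simp only: finite.intros simp_thms)
  qed
qed

lemma L2_approximable_add:
  assumes p: "\<And>i. p i \<in> L2 S" and f: "L2_approximable S p f" and g: "L2_approximable S p g"
  shows "L2_approximable S p (\<lambda>x. f x + g x)"
  unfolding L2_approximable_def
proof (intro conjI allI impI)
  have fg: "f \<in> L2 S" "g \<in> L2 S" using f g by (auto simp: L2_approximable_def)
  then show "(\<lambda>x. f x + g x) \<in> L2 S" by (rule L2_add)
  fix \<epsilon> :: real assume "\<epsilon> > 0"
  \<comment> \<open>\<open>L2norm2\<close> is a squared norm, and \<open>L2norm2_add_le\<close>
    doubles each of the two errors.\<close>
  then have "\<epsilon> / 4 > 0" by simp
  with f g obtain F c G d where F: "finite F" "L2norm2 S (\<lambda>x. f x - (\<Sum>i\<in>F. c i * p i x)) < \<epsilon> / 4"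
    and G: "finite G" "L2norm2 S (\<lambda>x. g x - (\<Sum>i\<in>G. d i * p i x)) < \<epsilon> / 4"
    unfolding L2_approximable_def by meson
  define k where "k i = (if i \<in> F then c i else 0) + (if i \<in> G then d i else 0)" for i
  have sum: "(\<Sum>i\<in>F \<union> G. k i * p i x) = (\<Sum>i\<in>F. c i * p i x) + (\<Sum>i\<in>G. d i * p i x)" for x
  proof -
    have "(\<Sum>i\<in>F \<union> G. k i * p i x) = (\<Sum>i\<in>F \<union> G. (if i \<in> F then c i * p i x else 0)) + (\<Sum>i\<in>F \<union> G. (if i \<in> G then d i * p i x else 0))"
      unfolding sum.distrib[symmetric] by (intro sum.cong) (auto simp: k_def algebra_simps)
    also have "(\<Sum>i\<in>F \<union> G. (if i \<in> F then c i * p i x else 0)) = (\<Sum>i\<in>F. c i * p i x)"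
      using F(1) G(1) by (subst sum.inter_restrict[symmetric]) (auto simp: Int_absorb1)
    also have "(\<Sum>i\<in>F \<union> G. (if i \<in> G then d i * p i x else 0)) = (\<Sum>i\<in>G. d i * p i x)"
      using F(1) G(1) by (subst sum.inter_restrict[symmetric]) (auto simp: Int_absorb1)
    finally show ?thesis .
  qed
  have "L2norm2 S (\<lambda>x. (f x - (\<Sum>i\<in>F. c i * p i x)) + (g x - (\<Sum>i\<in>G. d i * p i x)))
     \<le> 2 * L2norm2 S (\<lambda>x. f x - (\<Sum>i\<in>F. c i * p i x)) + 2 * L2norm2 S (\<lambda>x. g x - (\<Sum>i\<in>G. d i * p i x))"
    using fg F(1) G(1) p by (intro L2norm2_add_le L2_diff L2_sum L2_cmult) auto
  also have "\<dots> < \<epsilon>" using F(2) G(2) by simp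
  finally have "L2norm2 S (\<lambda>x. f x + g x - (\<Sum>i\<in>F \<union> G. k i * p i x)) < \<epsilon>"
    by (simp add: sum algebra_simps)
  then show "\<exists>F c. finite F \<and> L2norm2 S (\<lambda>x. f x + g x - (\<Sum>i\<in>F. c i * p i x)) < \<epsilon>"
    using F(1) G(1) by (intro exI[of _ "F \<union> G"] exI[of _ k] conjI) auto
qed

lemma L2_approximable_cmult:
  assumes f: "L2_approximable S p f"
  shows "L2_approximable S p (\<lambda>x. a * f x)"
  unfolding L2_approximable_def
proof (intro conjI allI impI)
  show "(\<lambda>x. a * f x) \<in> L2 S" using f by (auto simp: L2_approximable_def intro: L2_cmult)
  fix \<epsilon> :: real assume "\<epsilon> > 0"
  \<comment> \<open>The added 1 keeps the denominator positive when \<open>a\<close> is 0.\<close>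
  then have "\<epsilon> / (a\<^sup>2 + 1) > 0" by (simp add: add_nonneg_pos)
  with f obtain F c where F: "finite F" "L2norm2 S (\<lambda>x. f x - (\<Sum>i\<in>F. c i * p i x)) < \<epsilon> / (a\<^sup>2 + 1)"
    unfolding L2_approximable_def by meson
  have "L2norm2 S (\<lambda>x. a * f x - (\<Sum>i\<in>F. (a * c i) * p i x)) = L2norm2 S (\<lambda>x. a * (f x - (\<Sum>i\<in>F. c i * p i x)))"
    by (simp add: right_diff_distrib sum_distrib_left mult_ac)
  also have "\<dots> = a\<^sup>2 * L2norm2 S (\<lambda>x. f x - (\<Sum>i\<in>F. c i * p i x))"
    by (simp add: L2norm2_def power_mult_distrib)
  also have "\<dots> \<le> (a\<^sup>2 + 1) * L2norm2 S (\<lambda>x. f x - (\<Sum>i\<in>F. c i * p i x))"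
    by (intro mult_right_mono) (auto simp: L2norm2_def)
  also have "\<dots> < \<epsilon>"
    using F(2) by (simp add: less_divide_eq add_nonneg_pos mult.commute)
  finally show "\<exists>F c. finite F \<and> L2norm2 S (\<lambda>x. a * f x - (\<Sum>i\<in>F. c i * p i x)) < \<epsilon>"
    using F(1) by (intro exI[of _ F] exI[of _ "\<lambda>i. a * c i"] conjI)
qed

lemma L2_approximable_sum:
  assumes p: "\<And>i. p i \<in> L2 S" and "finite I" and f: "\<And>i. i \<in> I \<Longrightarrow> L2_approximable S p (f i)"
  shows "L2_approximable S p (\<lambda>x. \<Sum>i\<in>I. f i x)"
  using assms(2) f
proof (induction I rule: finite_induct)
  case empty
  have "L2_approximable S p (\<lambda>x. 0 * p undefined x)"
    by (intro L2_approximable_cmult L2_approximable_basis p)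
  then show ?case by simp
next
  case (insert i I)
  then show ?case by (simp add: L2_approximable_add[OF p])
qed

text \<open>The closed span under dominated convergence: both |h n| and |g| are at most
  \<open>w\<close>, so the squared difference is dominated by 4 w^2. Each of the three limits in the
  completeness proof (polynomials, clamped continuous functions, truncated quotients) goes through
  it.\<close>

lemma L2_approximable_tendsto:
  assumes p: "\<And>i. p i \<in> L2 S" and h: "\<And>n. L2_approximable S p (h n)"
    and g: "g \<in> borel_measurable (lebesgue_on S)" and w: "w \<in> L2 S"
    and le: "\<And>n. AE x in lebesgue_on S. \<bar>h n x\<bar> \<le> w x"
    and lim: "AE x in lebesgue_on S. (\<lambda>n. h n x) \<longlonglongrightarrow> g x"
  shows "L2_approximable S p g"
  unfolding L2_approximable_def
proof (intro conjI allI impI)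
  have hm: "h n \<in> L2 S" for n using h by (auto simp: L2_approximable_def)
  then have [measurable]: "h n \<in> borel_measurable (lebesgue_on S)" for n by (auto simp: L2_def)
  note g[measurable]
  have AE_all: "AE x in lebesgue_on S. \<forall>n. \<bar>h n x\<bar> \<le> w x"
    using le by (simp add: AE_all_countable)
  have gw: "AE x in lebesgue_on S. \<bar>g x\<bar> \<le> w x"
    using AE_all lim
  proof eventually_elim
    case (elim x)
    then show ?case by (intro LIMSEQ_le_const2[OF tendsto_rabs]) auto
  qed
  then show gL2: "g \<in> L2 S" by (rule L2_bound[OF w g])
  have "(\<lambda>n. LINT x|lebesgue_on S. (g x - h n x)\<^sup>2) \<longlonglongrightarrow> (LINT x|lebesgue_on S. 0 :: real)"
  proof (rule integral_dominated_convergence)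
    show "integrable (lebesgue_on S) (\<lambda>x. 4 * (w x)\<^sup>2)" using w by (simp add: L2_def)
    show "AE x in lebesgue_on S. (\<lambda>n. (g x - h n x)\<^sup>2) \<longlonglongrightarrow> 0"
      using lim
    proof eventually_elim
      case (elim x)
      then have "(\<lambda>n. (g x - h n x)\<^sup>2) \<longlonglongrightarrow> (g x - g x)\<^sup>2" by (intro tendsto_intros)
      then show ?case by simp
    qed
    show "AE x in lebesgue_on S. norm ((g x - h n x)\<^sup>2) \<le> 4 * (w x)\<^sup>2" for n
      using AE_all gw
    proof eventually_elim
      case (elim x)
      then have "\<bar>g x - h n x\<bar> \<le> \<bar>2 * w x\<bar>" by (auto dest: spec[of _ n])
      then have "(g x - h n x)\<^sup>2 \<le> (2 * w x)\<^sup>2" by (simp only: abs_le_square_iff)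
      then show ?case by (simp add: power_mult_distrib)
    qed
  qed auto
  then have conv: "(\<lambda>n. L2norm2 S (\<lambda>x. g x - h n x)) \<longlonglongrightarrow> 0"
    by (simp add: L2norm2_def)
  fix \<epsilon> :: real assume "\<epsilon> > 0"
  then have e4: "\<epsilon> / 4 > 0" by simp
  then have "\<forall>\<^sub>F n in sequentially. L2norm2 S (\<lambda>x. g x - h n x) < \<epsilon> / 4"
    using conv by (rule order_tendstoD[rotated])
  then obtain n where n: "L2norm2 S (\<lambda>x. g x - h n x) < \<epsilon> / 4"
    by (auto simp: eventually_sequentially)
  obtain F c where F: "finite F" "L2norm2 S (\<lambda>x. h n x - (\<Sum>i\<in>F. c i * p i x)) < \<epsilon> / 4"
    using h[of n] e4 unfolding L2_approximable_def by meson
  have "L2norm2 S (\<lambda>x. (g x - h n x) + (h n x - (\<Sum>i\<in>F. c i * p i x)))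
     \<le> 2 * L2norm2 S (\<lambda>x. g x - h n x) + 2 * L2norm2 S (\<lambda>x. h n x - (\<Sum>i\<in>F. c i * p i x))"
    using gL2 hm F(1) p by (intro L2norm2_add_le L2_diff L2_sum L2_cmult) auto
  also have "\<dots> < \<epsilon>" using n F(2) by simp
  finally show "\<exists>F c. finite F \<and> L2norm2 S (\<lambda>x. g x - (\<Sum>i\<in>F. c i * p i x)) < \<epsilon>"
    using F(1) by (intro exI[of _ F] exI[of _ c] conjI) simp_all
qed

text \<open>Applied with \<open>u\<close> one of \<open>sin (b t / 2)\<close>, \<open>cos (b t / 2)\<close> and \<open>v t = cos (b t)\<close>: the
  half-integer system consists of \<open>u\<close> times polynomials in \<open>v\<close>.\<close>

lemma L2_approximable_continuous_of_powers:
  fixes S :: "'a::euclidean_space set"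
  assumes p: "\<And>i. p i \<in> L2 S" and u: "\<And>m. L2_approximable S p (\<lambda>t. v t ^ m * u t)"
    and v: "\<And>t. v t \<in> {-1..1}" and vm: "v \<in> borel_measurable (lebesgue_on S)"
    and f: "continuous_on {-1..1} f"
  shows "L2_approximable S p (\<lambda>t. f (v t) * u t)"
proof -
  have "\<exists>g. real_polynomial_function g \<and> (\<forall>x\<in>{-1..1}. \<bar>f x - g x\<bar> < 1 / real (Suc n))" for n
  proof (rule Stone_Weierstrass_real_polynomial_function[of "{-1..1}" f "1 / real (Suc n)"])
    fix g assume "real_polynomial_function g" "\<And>x. x \<in> {-1..1} \<Longrightarrow> \<bar>f x - g x\<bar> < 1 / real (Suc n)"
    then show ?thesis by blast
  qed (use f in auto)
  then obtain P where P: "\<And>n. real_polynomial_function (P n)"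
    "\<And>n x. x \<in> {-1..1} \<Longrightarrow> \<bar>f x - P n x\<bar> < 1 / real (Suc n)"
    by metis
  have "bounded (f ` {-1..1})"
    using f by (intro compact_imp_bounded compact_continuous_image) auto
  then obtain B where "\<forall>y\<in>f ` {-1..1}. norm y \<le> B"
    unfolding bounded_iff by blast
  then have B: "\<bar>f x\<bar> \<le> B" if "x \<in> {-1..1}" for x
    using that by fastforce
  have uL2: "u \<in> L2 S" using u[of 0] by (simp add: L2_approximable_def)
  then have [measurable]: "u \<in> borel_measurable (lebesgue_on S)" by (simp add: L2_def)
  show ?thesis
  proof (rule L2_approximable_tendsto[OF p])
    show "L2_approximable S p (\<lambda>t. P n (v t) * u t)" for n
    proof -
      obtain c N where "P n = (\<lambda>x. \<Sum>i\<le>N. c i * x ^ i)"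
        using P(1)[of n] by (auto simp: real_polynomial_function_iff_sum)
      then have "(\<lambda>t. P n (v t) * u t) = (\<lambda>t. \<Sum>i\<le>N. c i * (v t ^ i * u t))"
        by (simp add: sum_distrib_right mult.assoc)
      then show ?thesis
        by (simp add: L2_approximable_sum[OF p] L2_approximable_cmult[OF u])
    qed
    \<comment> \<open>\<open>f\<close> is continuous on \<open>{-1..1}\<close> only; clamping its
      argument gives a globally continuous function that agrees with \<open>f\<close> on the values
      of \<open>v\<close>.\<close>
    have "(\<lambda>x. f (max (-1) (min 1 x))) \<in> borel_measurable borel"
      by (intro borel_measurable_continuous_onI continuous_on_compose2[OF f] continuous_intros) auto
    moreover have "max (-1) (min 1 (v t)) = v t" for t
      using v[of t] by simp
    ultimately have "(\<lambda>t. f (v t)) \<in> borel_measurable (lebesgue_on S)"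
      using measurable_compose[OF vm, of "\<lambda>x. f (max (-1) (min 1 x))" borel] by simp
    then show "(\<lambda>t. f (v t) * u t) \<in> borel_measurable (lebesgue_on S)"
      by measurable
    have "\<bar>P n x\<bar> \<le> B + 1" if "x \<in> {-1..1}" for n x
    proof -
      have "1 / real (Suc n) \<le> 1" by simp
      then show ?thesis using P(2)[OF that, of n] B[OF that] by linarith
    qed
    then show "AE t in lebesgue_on S. \<bar>P n (v t) * u t\<bar> \<le> (B + 1) * \<bar>u t\<bar>" for n
      using v by (simp add: abs_mult mult_right_mono)
    show "(\<lambda>t. (B + 1) * \<bar>u t\<bar>) \<in> L2 S"
      using uL2 by (intro L2_cmult) (simp add: L2_def)
    have "(\<lambda>n. P n x) \<longlonglongrightarrow> f x" if "x \<in> {-1..1}" for x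
    proof (rule LIMSEQ_I)
      fix r :: real assume "r > 0"
      then obtain N where N: "inverse (real (Suc N)) < r" using reals_Archimedean by blast
      show "\<exists>no. \<forall>n\<ge>no. norm (P n x - f x) < r"
      proof (intro exI allI impI)
        fix n assume "N \<le> n"
        then have "1 / real (Suc n) \<le> inverse (real (Suc N))" by (simp add: field_simps)
        then show "norm (P n x - f x) < r" using P(2)[OF that, of n] N by (simp add: abs_minus_commute)
      qed
    qed
    then show "AE t in lebesgue_on S. (\<lambda>n. P n (v t) * u t) \<longlonglongrightarrow> f (v t) * u t"
      using v by (intro AE_I2 tendsto_mult tendsto_const) blast
  qed
qed

section \<open>Completeness of the half-integer system\<close>

definition half_trig :: "real \<Rightarrow> nat \<times> bool \<Rightarrow> real \<Rightarrow> real" where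
  "half_trig b = (\<lambda>(n, k) t. if k then sin ((real n + 1/2) * b * t) else cos ((real n + 1/2) * b * t))"

lemma half_trig_L2: "half_trig b i \<in> L2 {a..c}"
  by (cases i; cases "snd i") (auto simp: half_trig_def intro!: L2_continuous_on continuous_intros)

text \<open>Multiplication by cos(b t) sends a member to half the sum of its two neighbours in
  frequency, hence keeps the span. The induction on the power needs the index \<open>n\<close> free,
  since it moves at each step.\<close>

lemma L2_approximable_half_trig_powers:
  "L2_approximable {a..c} (half_trig b) (\<lambda>t. cos (b * t) ^ m * half_trig b (n, k) t)"
proof (induction m arbitrary: n)
  case 0
  show ?case by (simp add: L2_approximable_basis half_trig_L2)
next
  case (Suc m)
  \<comment> \<open>The lower neighbour of frequency 1/2 is -1/2, which reflects back to index 0: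
    unchanged for the cosine, with sign -1 for the sine.\<close>
  define j where "j = (if n = 0 then 0 else n - 1)"
  define s where "s = (if n = 0 \<and> k then -1 else (1::real))"
  have *: "cos (b * t) * half_trig b (n, k) t = 1/2 * half_trig b (Suc n, k) t + 1/2 * (s * half_trig b (j, k) t)" for t
  proof -
    have trig: "cos B * (if k then sin A else cos A)
        = 1/2 * (if k then sin (A + B) else cos (A + B)) + 1/2 * (if k then sin (A - B) else cos (A - B))" for A B :: real
      by (simp add: sin_add sin_diff cos_add cos_diff field_simps)
    have "(real (Suc n) + 1/2) * b * t = (real n + 1/2) * b * t + b * t"
      by (simp add: algebra_simps)
    then have 1: "half_trig b (Suc n, k) t = (if k then sin ((real n + 1/2) * b * t + b * t) else cos ((real n + 1/2) * b * t + b * t))"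
      by (simp only: half_trig_def prod.case)
    have 2: "s * half_trig b (j, k) t = (if k then sin ((real n + 1/2) * b * t - b * t) else cos ((real n + 1/2) * b * t - b * t))"
    proof (cases "n = 0")
      case True
      then have "(real n + 1/2) * b * t - b * t = - ((real j + 1/2) * b * t)"
        by (simp add: j_def)
      then show ?thesis
        using True by (cases k) (simp_all only: half_trig_def prod.case s_def sin_minus cos_minus, simp_all)
    next
      case False
      then have "(real n + 1/2) * b * t - b * t = (real j + 1/2) * b * t"
        by (simp add: j_def of_nat_diff algebra_simps)
      then show ?thesis
        using False by (cases k) (simp_all only: half_trig_def prod.case s_def, simp_all)
    qed
    have 3: "half_trig b (n, k) t = (if k then sin ((real n + 1/2) * b * t) else cos ((real n + 1/2) * b * t))"
      by (simp add: half_trig_def)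
    show ?thesis
      unfolding 1 2 3 by (rule trig)
  qed
  have "cos (b * t) ^ Suc m * half_trig b (n, k) t
     = 1/2 * (cos (b * t) ^ m * half_trig b (Suc n, k) t) + 1/2 * s * (cos (b * t) ^ m * half_trig b (j, k) t)" for t
  proof -
    have "C ^ Suc m * h = 1/2 * (C ^ m * x) + 1/2 * s * (C ^ m * y)"
      if "C * h = 1/2 * x + 1/2 * (s * y)" for C h x y :: real
    proof -
      have "C ^ Suc m * h = C ^ m * (C * h)" by simp
      also have "\<dots> = 1/2 * (C ^ m * x) + 1/2 * s * (C ^ m * y)"
        unfolding that by (simp add: algebra_simps)
      finally show ?thesis .
    qed
    then show ?thesis using * by blast
  qed
  then show ?case
    by (simp only:) (intro L2_approximable_add half_trig_L2 L2_approximable_cmult Suc)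
qed

text \<open>On the interval cos(b t) determines t up to sign, and evenness of \<open>l\<close>
  removes this ambiguity. The factor is \<open>l\<close> composed with arccos / b.\<close>

lemma cos_eq_even:
  fixes l :: "real \<Rightarrow> real"
  assumes b: "0 < b" and l: "continuous_on UNIV l" and even: "\<And>t. l (- t) = l t"
  obtains f where "continuous_on {-1..1} f" "\<And>t. t \<in> {-pi/b..pi/b} \<Longrightarrow> l t = f (cos (b * t))"
proof
  show "continuous_on {-1..1} (\<lambda>x. l (arccos x / b))"
    by (rule continuous_on_compose2[OF l]) (use b in \<open>auto intro!: continuous_intros\<close>)
  show "l t = l (arccos (cos (b * t)) / b)" if "t \<in> {-pi/b..pi/b}" for t
  proof -
    have "\<bar>b * t\<bar> \<le> pi"
      using that b by (auto simp: abs_le_iff field_simps)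
    then have "arccos (cos (b * t)) = \<bar>b * t\<bar>"
      by (metis abs_ge_zero arccos_cos cos_abs_real)
    then show ?thesis
      using b even[of t] by (auto simp: abs_mult abs_if)
  qed
qed

text \<open>Weierstrass approximation reaches only even functions times sin(b t / 2) or cos(b t /
  2). Writing a general function in this form would require dividing by factors that vanish at 0 or
  at the ends; the factor sin(b t) supplies both half-angle factors and makes the division
  unnecessary.\<close>

lemma L2_approximable_sin_continuous:
  fixes k :: "real \<Rightarrow> real"
  assumes b: "0 < b" and k: "continuous_on UNIV k"
  shows "L2_approximable {-pi/b..pi/b} (half_trig b) (\<lambda>t. sin (b * t) * k t)"
proof -
  have cosm: "(\<lambda>t. cos (b * t)) \<in> borel_measurable (lebesgue_on {-pi/b..pi/b})"
    by (intro continuous_imp_measurable_on_sets_lebesgue continuous_intros) auto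
  have main: "L2_approximable {-pi/b..pi/b} (half_trig b) (\<lambda>t. l t * half_trig b (0, q) t)"
    if l: "continuous_on UNIV l" "\<And>t. l (- t) = l t" for l q
  proof -
    obtain f where f: "continuous_on {-1..1} f" "\<And>t. t \<in> {-pi/b..pi/b} \<Longrightarrow> l t = f (cos (b * t))"
      using cos_eq_even[OF b l] by blast
    have "L2_approximable {-pi/b..pi/b} (half_trig b) (\<lambda>t. f (cos (b * t)) * half_trig b (0, q) t)"
      by (rule L2_approximable_continuous_of_powers[OF half_trig_L2 L2_approximable_half_trig_powers _ cosm f(1)]) simp
    then show ?thesis
      using f(2) by (subst L2_approximable_cong) auto
  qed
  have cont: "continuous_on UNIV (\<lambda>t. k (- t))"
    by (intro continuous_on_compose2[OF k] continuous_intros) auto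
  define ke ko where "ke t = (k t + k (- t)) / 2" and "ko t = (k t - k (- t)) / 2" for t
  \<comment> \<open>\<open>sin (b t) = 2 sin (b t / 2) cos (b t / 2)\<close>; each half angle factor is paired with the part of
    \<open>k\<close> that makes the remaining factor even.\<close>
  have "L2_approximable {-pi/b..pi/b} (half_trig b)
      (\<lambda>t. (2 * cos (b * t / 2) * ke t) * half_trig b (0, True) t + (2 * sin (b * t / 2) * ko t) * half_trig b (0, False) t)"
    unfolding ke_def ko_def
    by (intro L2_approximable_add half_trig_L2 main continuous_intros k cont) (auto simp: field_simps)
  moreover have "(2 * cos (b * t / 2) * ke t) * half_trig b (0, True) t + (2 * sin (b * t / 2) * ko t) * half_trig b (0, False) t
      = sin (b * t) * k t" for t
  proof -
    have "sin (b * t) = 2 * sin (b * t / 2) * cos (b * t / 2)"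
      using sin_double[of "b * t / 2"] by simp
    moreover have "k t = ke t + ko t"
      by (simp add: ke_def ko_def field_simps)
    ultimately show ?thesis by (simp add: half_trig_def algebra_simps)
  qed
  ultimately show ?thesis by simp
qed

text \<open>A measurable function is an almost everywhere limit of continuous ones. Clamping these
  to [-C, C] keeps them continuous, leaves the limit \<open>f\<close> unchanged and provides the
  constant majorant \<open>C\<close>.\<close>

lemma L2_approximable_sin_bounded:
  fixes f :: "real \<Rightarrow> real"
  assumes b: "0 < b" and f: "f \<in> borel_measurable (lebesgue_on {-pi/b..pi/b})" and C: "\<And>t. \<bar>f t\<bar> \<le> C"
  shows "L2_approximable {-pi/b..pi/b} (half_trig b) (\<lambda>t. sin (b * t) * f t)"
proof -
  define S where "S = {-pi/b..pi/b}"
  have "f measurable_on S"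
    using f by (subst measurable_on_iff_borel_measurable) (auto simp: S_def)
  then obtain N g where N: "negligible N" and g: "\<And>n. continuous_on UNIV (g n)"
    and lim: "\<And>t. t \<notin> N \<Longrightarrow> (\<lambda>n. g n t) \<longlonglongrightarrow> (if t \<in> S then f t else 0)"
    unfolding measurable_on_def by blast
  define h where "h n t = max (- C) (min C (g n t))" for n t
  have "0 \<le> C" using C[of 0] by simp
  have "AE t in lebesgue. t \<notin> N"
    using N by (intro AE_not_in) (simp add: negligible_iff_null_sets)
  then have aeN: "AE t in lebesgue_on S. t \<notin> N"
    by (subst AE_restrict_space_iff) (auto simp: S_def)
  have sinm: "(\<lambda>t. sin (b * t)) \<in> borel_measurable (lebesgue_on S)"
    unfolding S_def by (intro continuous_imp_measurable_on_sets_lebesgue continuous_intros) auto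
  show ?thesis
    unfolding S_def[symmetric]
  proof (rule L2_approximable_tendsto[where h = "\<lambda>n t. sin (b * t) * h n t" and w = "\<lambda>_. C"])
    show "half_trig b i \<in> L2 S" for i
      unfolding S_def by (rule half_trig_L2)
    show "L2_approximable S (half_trig b) (\<lambda>t. sin (b * t) * h n t)" for n
      unfolding S_def h_def by (intro L2_approximable_sin_continuous b continuous_intros g)
    show "(\<lambda>t. sin (b * t) * f t) \<in> borel_measurable (lebesgue_on S)"
      using f sinm by (simp add: S_def)
    show "(\<lambda>_. C) \<in> L2 S"
      unfolding S_def by (intro L2_continuous_on continuous_intros)
    have "\<bar>sin (b * t) * h n t\<bar> \<le> C" for n t
    proof -
      have "\<bar>h n t\<bar> \<le> C" using \<open>0 \<le> C\<close> by (auto simp: h_def)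
      then have "\<bar>sin (b * t)\<bar> * \<bar>h n t\<bar> \<le> 1 * C" by (intro mult_mono) auto
      then show ?thesis by (simp add: abs_mult)
    qed
    then show "AE t in lebesgue_on S. \<bar>sin (b * t) * h n t\<bar> \<le> C" for n
      by simp
    show "AE t in lebesgue_on S. (\<lambda>n. sin (b * t) * h n t) \<longlonglongrightarrow> sin (b * t) * f t"
      using aeN AE_space
    proof eventually_elim
      case (elim t)
      then have "(\<lambda>n. g n t) \<longlonglongrightarrow> f t"
        using lim[of t] by (simp add: space_restrict_space)
      then have "(\<lambda>n. h n t) \<longlonglongrightarrow> max (- C) (min C (f t))"
        unfolding h_def by (intro tendsto_intros)
      moreover have "max (- C) (min C (f t)) = f t"
        using C[of t] by auto
      ultimately show ?case by (intro tendsto_intros) simp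
    qed
  qed
qed

text \<open>Dividing by \<open>sin (b t)\<close>, truncated where the quotient is large, reduces to the previous lemma; the
  zeros of \<open>sin (b t)\<close> on the interval form a null set.\<close>

lemma L2_approximable_half_trig:
  assumes b: "0 < b" and g: "g \<in> L2 {-pi/b..pi/b}"
  shows "L2_approximable {-pi/b..pi/b} (half_trig b) g"
proof -
  define S where "S = {-pi/b..pi/b}"
  \<comment> \<open>The cut-off makes \<open>f n\<close> bounded by n, while sin(b t) times
    \<open>f n\<close> is either g t or 0 and so is dominated by |g|. Off the zeros of the sine it
    equals g t for all large n.\<close>
  define f where "f n t = (if \<bar>g t\<bar> \<le> real n * \<bar>sin (b * t)\<bar> then g t / sin (b * t) else 0)" for n t
  have gm[measurable]: "g \<in> borel_measurable (lebesgue_on S)"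
    using g by (simp add: L2_def S_def)
  have sinm[measurable]: "(\<lambda>t. sin (b * t)) \<in> borel_measurable (lebesgue_on S)"
    unfolding S_def by (intro continuous_imp_measurable_on_sets_lebesgue continuous_intros) auto
  have "\<bar>f n t\<bar> \<le> real n" for n t
    by (auto simp: f_def divide_le_eq)
  moreover have "f n \<in> borel_measurable (lebesgue_on S)" for n
    unfolding f_def[abs_def] by measurable
  ultimately have approx: "L2_approximable S (half_trig b) (\<lambda>t. sin (b * t) * f n t)" for n
    unfolding S_def by (intro L2_approximable_sin_bounded b)
  have "AE t in lebesgue. t \<notin> {-pi/b, 0, pi/b}"
    by (intro AE_not_in) (simp add: negligible_iff_null_sets[symmetric])
  then have ae: "AE t in lebesgue_on S. t \<notin> {-pi/b, 0, pi/b}"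
    by (subst AE_restrict_space_iff) (auto simp: S_def)
  show ?thesis
    unfolding S_def[symmetric]
  proof (rule L2_approximable_tendsto[OF _ approx gm])
    show "half_trig b i \<in> L2 S" for i
      unfolding S_def by (rule half_trig_L2)
    show "(\<lambda>t. \<bar>g t\<bar>) \<in> L2 S"
      using g unfolding S_def[symmetric] by (simp add: L2_def)
    show "AE t in lebesgue_on S. \<bar>sin (b * t) * f n t\<bar> \<le> \<bar>g t\<bar>" for n
      by (rule AE_I2) (simp add: f_def)
    show "AE t in lebesgue_on S. (\<lambda>n. sin (b * t) * f n t) \<longlonglongrightarrow> g t"
      using ae AE_space
    proof eventually_elim
      case (elim t)
      then have "- pi < b * t" "b * t < pi" "b * t \<noteq> 0"
        using b by (auto simp: space_restrict_space S_def field_simps)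
      then have nz: "sin (b * t) \<noteq> 0" using sin_eq_0_pi by blast
      obtain N :: nat where N: "\<bar>g t\<bar> / \<bar>sin (b * t)\<bar> \<le> real N"
        using real_arch_simple by blast
      have "sin (b * t) * f n t = g t" if "N \<le> n" for n
      proof -
        have "\<bar>g t\<bar> / \<bar>sin (b * t)\<bar> \<le> real n" using N that by linarith
        then show ?thesis using nz by (simp add: f_def divide_le_eq)
      qed
      then have "\<forall>\<^sub>F n in sequentially. sin (b * t) * f n t = g t"
        by (auto simp: eventually_sequentially)
      then show ?case by (rule tendsto_eventually)
    qed
  qed
qed

section \<open>Orthogonality and the Riesz bounds\<close>

lemma integral_trig_period:
  fixes b :: real and m :: int
  assumes b: "0 < b"
  shows "(LINT t|lebesgue_on {-pi/b..pi/b}. cos (of_int m * b * t)) = (if m = 0 then 2 * pi / b else 0)"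
    and "(LINT t|lebesgue_on {-pi/b..pi/b}. sin (of_int m * b * t)) = 0"
proof -
  have le: "-pi/b \<le> pi/b" using b by (simp add: field_simps)
  have eq: "(LINT t|lebesgue_on {-pi/b..pi/b}. f t) = integral {-pi/b..pi/b} f" if "continuous_on UNIV f" for f :: "real \<Rightarrow> real"
    using that by (intro lebesgue_integral_eq_integral continuous_imp_integrable_real) (auto intro: continuous_on_subset)
  note fund = has_integral_DERIV[OF le]
  have ends: "of_int m * b * (pi / b) = of_int m * pi" "of_int m * b * (-pi / b) = - (of_int m * pi)"
    using b by auto
  show "(LINT t|lebesgue_on {-pi/b..pi/b}. cos (of_int m * b * t)) = (if m = 0 then 2 * pi / b else 0)"
  proof (cases "m = 0")
    case True
    then show ?thesis
      using b le by (subst eq) (auto simp: content_real)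
  next
    case False
    have "((\<lambda>t. cos (of_int m * b * t)) has_integral
        sin (of_int m * b * (pi/b)) / (of_int m * b) - sin (of_int m * b * (-pi/b)) / (of_int m * b)) {-pi/b..pi/b}"
      using False b by (intro fund) (auto intro!: derivative_eq_intros)
    then have "integral {-pi/b..pi/b} (\<lambda>t. cos (of_int m * b * t)) = 0"
      unfolding ends by (simp add: integral_unique mult.commute[of _ pi] sin_integer_2pi)
    then show ?thesis
      using False by (subst eq) (auto intro!: continuous_intros)
  qed
  show "(LINT t|lebesgue_on {-pi/b..pi/b}. sin (of_int m * b * t)) = 0"
  proof (cases "m = 0")
    case False
    have "((\<lambda>t. sin (of_int m * b * t)) has_integral
        - cos (of_int m * b * (pi/b)) / (of_int m * b) - - cos (of_int m * b * (-pi/b)) / (of_int m * b)) {-pi/b..pi/b}"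
      using False b by (intro fund) (auto intro!: derivative_eq_intros)
    then have "integral {-pi/b..pi/b} (\<lambda>t. sin (of_int m * b * t)) = 0"
      unfolding ends by (simp add: integral_unique)
    then show ?thesis
      by (subst eq) (auto intro!: continuous_intros)
  qed simp
qed

text \<open>In the product formulas the half-integers combine to integer frequencies, the difference
  \<open>p\<close> and the sum \<open>q\<close>. Since q = n + n' + 1 is never 0, only p = 0
  contributes, with half of the period 2 pi / b, and mixed products give sines of mean zero.\<close>

lemma half_trig_orthogonal:
  assumes b: "0 < b"
  shows "(LINT t|lebesgue_on {-pi/b..pi/b}. half_trig b i t * half_trig b j t) = (if i = j then pi / b else 0)"
proof -
  obtain n k n' k' where ij: "i = (n, k)" "j = (n', k')" by (cases i, cases j) auto
  define S where "S = {-pi/b..pi/b}"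
  define p q where "p = int n - int n'" and "q = int n + int n' + 1"
  define s c where "s = (\<lambda>m t. sin (of_int m * b * t))" and "c = (\<lambda>m t. cos (of_int m * b * t))"
  have int: "integrable (lebesgue_on S) (s m)" "integrable (lebesgue_on S) (c m)" for m :: int
    unfolding s_def c_def S_def by (intro continuous_imp_integrable_real continuous_intros)+
  have vals: "(LINT t|lebesgue_on S. s m t) = 0"
    "(LINT t|lebesgue_on S. c m t) = (if m = 0 then 2 * pi / b else 0)" for m
    unfolding s_def c_def S_def by (rule integral_trig_period[OF b])+
  have q0: "q \<noteq> 0" by (simp add: q_def)
  have arg: "of_int p * b * t = (real n + 1/2) * b * t - (real n' + 1/2) * b * t"
    "of_int q * b * t = (real n + 1/2) * b * t + (real n' + 1/2) * b * t" for t
    by (simp_all add: p_def q_def algebra_simps)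
  have prod: "half_trig b i t * half_trig b j t =
     (if k then if k' then (c p t - c q t) / 2 else (s q t + s p t) / 2
      else if k' then (s q t - s p t) / 2 else (c p t + c q t) / 2)" for t
    unfolding s_def c_def arg ij half_trig_def
    by (simp add: sin_add sin_diff cos_add cos_diff)
  show ?thesis
    unfolding prod S_def[symmetric] using int q0 by (cases k; cases k') (auto simp: vals ij p_def)
qed

lemma L2norm2_half_trig:
  assumes b: "0 < b" and F: "finite F"
  shows "L2norm2 {-pi/b..pi/b} (\<lambda>t. \<Sum>i\<in>F. c i * half_trig b i t) = pi / b * (\<Sum>i\<in>F. (c i)\<^sup>2)"
proof -
  have int: "integrable (lebesgue_on {-pi/b..pi/b}) (\<lambda>t. half_trig b i t * half_trig b j t)" for i j
    by (cases i; cases j; cases "snd i"; cases "snd j")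
       (auto simp: half_trig_def intro!: continuous_imp_integrable_real continuous_intros)
  have "L2norm2 {-pi/b..pi/b} (\<lambda>t. \<Sum>i\<in>F. c i * half_trig b i t)
      = (LINT t|lebesgue_on {-pi/b..pi/b}. (\<Sum>i\<in>F. \<Sum>j\<in>F. c i * c j * (half_trig b i t * half_trig b j t)))"
    by (simp add: L2norm2_def power2_eq_square sum_product mult_ac)
  also have "\<dots> = (\<Sum>i\<in>F. \<Sum>j\<in>F. c i * c j * (LINT t|lebesgue_on {-pi/b..pi/b}. half_trig b i t * half_trig b j t))"
    using int by simp
  also have "\<dots> = (\<Sum>i\<in>F. c i * c i * (pi / b))"
    unfolding half_trig_orthogonal[OF b] using F by (simp add: if_distrib cong: if_cong)
  also have "\<dots> = pi / b * (\<Sum>i\<in>F. (c i)\<^sup>2)"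
    by (simp add: sum_distrib_left power2_eq_square mult_ac)
  finally show ?thesis .
qed

lemma riesz_basis_half_trig:
  assumes b: "0 < b"
  shows "riesz_basis {-pi/b..pi/b} (half_trig b)"
  unfolding riesz_basis_def
proof (intro conjI ballI allI impI)
  show "half_trig b i \<in> L2 {-pi/b..pi/b}" for i
    by (rule half_trig_L2)
  show "\<exists>F c. finite F \<and> L2norm2 {-pi/b..pi/b} (\<lambda>x. g x - (\<Sum>i\<in>F. c i * half_trig b i x)) < \<epsilon>"
    if "g \<in> L2 {-pi/b..pi/b}" "\<epsilon> > 0" for g \<epsilon>
    using L2_approximable_half_trig[OF b that(1)] that(2) by (auto simp: L2_approximable_def)
  show "\<exists>A B. 0 < A \<and> A \<le> B \<and> (\<forall>F (c :: nat \<times> bool \<Rightarrow> real). finite F \<longrightarrow>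
      A * (\<Sum>i\<in>F. (c i)\<^sup>2) \<le> L2norm2 {-pi/b..pi/b} (\<lambda>x. \<Sum>i\<in>F. c i * half_trig b i x) \<and>
      L2norm2 {-pi/b..pi/b} (\<lambda>x. \<Sum>i\<in>F. c i * half_trig b i x) \<le> B * (\<Sum>i\<in>F. (c i)\<^sup>2))"
    using b by (intro exI[of _ "pi / b"] conjI allI impI) (simp_all only: L2norm2_half_trig[OF b] order_refl divide_pos_pos pi_gt_zero)
qed

text \<open>Needed because the theorem admits every decreasing enumeration of the eigenvalues, which
  has to be identified with the explicit one. If the sequences agree below n, the value v n is u j
  for some j; j < n would give v n = v j, against strict decrease, so j is at least n and v n is at
  most u n. The roles are then exchanged.\<close>

lemma strictly_decreasing_range_unique:
  fixes f g :: "nat \<Rightarrow> 'a::linorder"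
  assumes f: "\<And>m n. m < n \<Longrightarrow> f n < f m" and g: "\<And>m n. m < n \<Longrightarrow> g n < g m"
    and range: "range f = range g"
  shows "f = g"
proof
  have le: "v n \<le> u n"
    if u: "\<And>m n. m < n \<Longrightarrow> u n < u m" and v: "\<And>m n. m < n \<Longrightarrow> v n < v m"
      and r: "range u = range v" and eq: "\<And>m. m < n \<Longrightarrow> u m = v m" for u v :: "nat \<Rightarrow> 'a" and n
  proof -
    obtain j where j: "v n = u j" using r by (metis rangeE rangeI)
    have "\<not> j < n"
    proof
      assume "j < n"
      then have "u j = v j" "v n < v j" using eq v by auto
      then show False using j by simp
    qed
    then show ?thesis
      using u[of n j] j by (cases "j = n") auto
  qed
  show "f n = g n" for n
  proof (induction n rule: less_induct)
    case (less n)
    show ?case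
      by (rule antisym; rule le) (use f g range less in auto)
  qed
qed

theorem theorem1p2:
  fixes z :: "real^3" and a c\<^sub>1 :: real
  assumes "a > 0" and "c\<^sub>1 > 0"
  defines "D \<equiv> ball z a" and "b \<equiv> c\<^sub>1 * pi / a"
  shows "(\<exists>lam :: nat \<Rightarrow> real. (\<forall>m n. m < n \<longrightarrow> lam n < lam m) \<and>
                             range lam = {\<mu>. newton_eig_mean D \<mu>}) \<and>
         (\<forall>lam :: nat \<Rightarrow> real. (\<forall>m n. m < n \<longrightarrow> lam n < lam m) \<and>
                             range lam = {\<mu>. newton_eig_mean D \<mu>} \<longrightarrow>
            riesz_basis {-pi/b..pi/b}
              (\<lambda>(n::nat, k::bool) t. if k then sin (c\<^sub>1 / sqrt (lam n) * t)
                                      else cos (c\<^sub>1 / sqrt (lam n) * t)))"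
proof -
  define ev where "ev n = (a / ((real n + 1/2) * pi))\<^sup>2" for n
  have b: "0 < b" using assms by (simp add: b_def)
  have range: "range ev = {\<mu>. newton_eig_mean D \<mu>}"
    unfolding D_def newton_eig_mean_iff[OF \<open>a > 0\<close>] by (auto simp: ev_def)
  have dec: "ev n < ev m" if "m < n" for m n
    unfolding ev_def using that \<open>a > 0\<close>
    by (intro power_strict_mono divide_strict_left_mono mult_strict_right_mono) auto
  \<comment> \<open>Here sqrt of the eigenvalue is a / ((n + 1/2) pi), and c1 pi / a is exactly
    \<open>b\<close>; thus the family in the claim becomes \<open>half_trig b\<close>.\<close>
  have freq: "c\<^sub>1 / sqrt (ev n) = (real n + 1/2) * b" for n
    using \<open>a > 0\<close> by (simp add: ev_def b_def)
  have "riesz_basis {-pi/b..pi/b} (\<lambda>(n::nat, k::bool) t. if k then sin (c\<^sub>1 / sqrt (lam n) * t)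
                                      else cos (c\<^sub>1 / sqrt (lam n) * t))"
    if "\<forall>m n. m < n \<longrightarrow> lam n < lam m" "range lam = {\<mu>. newton_eig_mean D \<mu>}" for lam
  proof -
    have "lam = ev"
      using that dec range by (intro strictly_decreasing_range_unique) auto
    then show ?thesis
      using riesz_basis_half_trig[OF b] by (simp only: freq half_trig_def)
  qed
  then show ?thesis
    using range dec by blast
qed

end
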